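(* Let $P\subseteq\mathbb{R}^n$ be an $n$-dimensional lattice polytope which is not unimodularly equivalent to $\Delta_n$. Define \[d(P):=\begin{cases} 2\,(n-\lfloor \mu(P)\rfloor) & \text{if } \mu(P)\notin\mathbb{N},\\ 2\,(n-\mu(P))+1 & \text{if } \mu(P)\in\mathbb{N}.\end{cases}\] If $n>d(P)$, then $P$ is unimodularly equivalent to a Cayley sum $P_0*\cdots*P_t$ of lattice polytopes $P_0,\dots,P_t\subseteq\mathbb{R}^m$ with $m\le d(P)$.
   Context: Write $P$ irredundantly as $P=\{x\in\mathbb{R}^n:\langle a_i,x\rangle\ge b_i,\ i=1,\dots,m'\}$ with primitive $a_i\in(\mathbb{Z}^n)^*$, $b_i\in\mathbb{Q}$, each inequality defining a facet of $P$. Put $d_P(x):=\min_i(\langle a_i,x\rangle-b_i)$ and, for $s\ge 0$, $P^{(s)}:=\{x\in\mathbb{R}^n: d_P(x)\ge s\}$. The $\mathbb{Q}$-codegree is $\mu(P):=(\sup\{s>0: P^{(s)}\neq\emptyset\})^{-1}$. $\Delta_n=\mathrm{conv}(0,e_1,\dots,e_n)$ is the unimodular simplex. Two lattice polytopes are unimodularly equivalent if an affine lattice automorphism of $\mathbb{Z}^n$ maps one onto the other. For lattice polytopes $P_0,\dots,P_t\subseteq\mathbb{R}^k$, the Cayley sum $P_0*\cdots*P_t$ is the convex hull of $(P_0\times 0)\cup(P_1\times e_1)\cup\cdots\cup(P_t\times e_t)$ in $\mathbb{R}^k\times\mathbb{R}^t$, where $e_1,\dots,e_t$ is the standard basis of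 $\mathbb{R}^t$; "$P$ is unimodularly equivalent to $P_0*\cdots*P_t$" means there is an affine lattice basis identifying $\mathbb{Z}^n\cong\mathbb{Z}^k\times\mathbb{Z}^t$ under which $P$ becomes this Cayley sum. *)

theory Defs
  imports "HOL-Analysis.Analysis"
begin

definition lattice_point :: "real^'n \<Rightarrow> bool" where
  "lattice_point x \<longleftrightarrow> (\<forall>i. x $ i \<in> \<int>)"

definition lattice_polytope :: "(real^'n) set \<Rightarrow> bool" where
  "lattice_polytope P \<longleftrightarrow>
     (\<exists>S. finite S \<and> S \<noteq> {} \<and> (\<forall>x\<in>S. lattice_point x) \<and> P = convex hull S)"

text \<open>Primitive vector of the dual lattice (identified with Z^n via the standard inner product).\<close>
definition primitive :: "real^'n \<Rightarrow> bool" where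
  "primitive a \<longleftrightarrow> a \<noteq> 0 \<and> lattice_point a \<and>
     (\<forall>k::int. k > 0 \<and> (\<forall>i. \<exists>z::int. a $ i = of_int k * of_int z) \<longrightarrow> k = 1)"

definition facet_ineq :: "(real^'n) set \<Rightarrow> real^'n \<Rightarrow> real \<Rightarrow> bool" where
  "facet_ineq P a b \<longleftrightarrow> primitive a \<and>
     (\<exists>F. F facet_of P \<and> (\<forall>y\<in>F. inner a y = b)) \<and> (\<forall>y\<in>P. inner a y \<ge> b)"

text \<open>P^(s) = {x. d_P(x) >= s}, where d_P(x) = min over facet inequalities of <a_i,x> - b_i.\<close>
definition adj_poly :: "(real^'n) set \<Rightarrow> real \<Rightarrow> (real^'n) set" where
  "adj_poly P s = {x. \<forall>a b. facet_ineq P a b \<longrightarrow> inner a x - b \<ge> s}"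

definition Q_codegree :: "(real^'n) set \<Rightarrow> real" where
  "Q_codegree P = inverse (Sup {s. s > 0 \<and> adj_poly P s \<noteq> {}})"

definition dP :: "(real^'n) set \<Rightarrow> real" where
  "dP P = (let \<mu> = Q_codegree P; n = real CARD('n) in
     if \<mu> \<in> \<nat> then 2 * (n - \<mu>) + 1 else 2 * (n - of_int \<lfloor>\<mu>\<rfloor>))"

definition unimodular_simplex :: "(real^'n) set" where
  "unimodular_simplex = convex hull (insert 0 (range (\<lambda>i. axis i 1)))"

definition affine_lattice_aut :: "(real^'n \<Rightarrow> real^'n) \<Rightarrow> bool" where
  "affine_lattice_aut f \<longleftrightarrow> (\<exists>A::real^'n^'n. \<exists>b.
     (\<forall>i j. A $ i $ j \<in> \<int>) \<and> \<bar>det A\<bar> = 1 \<and> lattice_point b \<and> f = (\<lambda>x. A *v x + b))"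

definition unimod_equiv :: "(real^'n) set \<Rightarrow> (real^'n) set \<Rightarrow> bool" where
  "unimod_equiv P Q \<longleftrightarrow> (\<exists>f. affine_lattice_aut f \<and> f ` P = Q)"

text \<open>Cayley sum: the coordinates in T play the role of R^t (basis e_j, j \<in> T), the
  remaining coordinates the role of R^m (m = card of the complement of T).  P0 and Q j
  (j \<in> T) live in the subspace where all T-coordinates vanish.\<close>
definition cayley_sum :: "'n set \<Rightarrow> (real^'n) set \<Rightarrow> ('n \<Rightarrow> (real^'n) set) \<Rightarrow> (real^'n) set" where
  "cayley_sum T P0 Q = convex hull (P0 \<union> (\<Union>j\<in>T. (\<lambda>x. x + axis j 1) ` Q j))"

definition in_base_space :: "'n set \<Rightarrow> (real^'n) set \<Rightarrow> bool" where
  "in_base_space T S \<longleftrightarrow> (\<forall>x\<in>S. \<forall>i\<in>T. x $ i = 0)"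

end

theory Submission
  imports Defs
begin

text \<open>
  Write the facet inequalities as lattice affine functions \<open>w\<^sub>i = \<langle>a\<^sub>i, \<cdot>\<rangle> - b\<^sub>i\<close>. By linear
  programming duality \<open>\<mu>(P)\<close> is the maximum of \<open>\<Sum> c\<^sub>i\<close> over all \<open>c \<ge> 0\<close> with \<open>\<Sum> c\<^sub>i w\<^sub>i = 1\<close>, and it is
  attained with at most \<open>n + 1\<close> nonzero weights. Since the \<open>w\<^sub>i\<close> take natural values at the vertices,
  all weights are at most 1, and the \<open>w\<^sub>i\<close> with weight above 1/2, of which there are at least
  \<open>2\<mu> - n - 1\<close>, have sum 0 or 1 at each vertex. Together with the remainder \<open>1 - \<Sum> w\<^sub>i\<close> they are lattice
  affine functions with values in \<open>{0, 1}\<close> and sum 1 on the vertices, and \<open>t + 1\<close> such functions exhibit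
  \<open>P\<close> as a Cayley sum of \<open>t + 1\<close> polytopes in dimension \<open>n - t\<close>. If the remainder vanishes, all
  weights are 1, which settles the count unless \<open>t = n\<close>, where \<open>P\<close> is the unimodular simplex.
\<close>

section \<open>Lattice automorphisms\<close>

lemma lattice_point_add: "lattice_point x \<Longrightarrow> lattice_point y \<Longrightarrow> lattice_point (x + y)"
  by (simp add: lattice_point_def)

lemma lattice_point_diff: "lattice_point x \<Longrightarrow> lattice_point y \<Longrightarrow> lattice_point (x - y)"
  by (simp add: lattice_point_def)

lemma lattice_point_scaleR: "c \<in> \<int> \<Longrightarrow> lattice_point x \<Longrightarrow> lattice_point (c *\<^sub>R x)"
  by (simp add: lattice_point_def)

lemma lattice_point_sum: "(\<And>i. i \<in> A \<Longrightarrow> lattice_point (f i)) \<Longrightarrow> lattice_point (sum f A)"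
  by (auto simp: lattice_point_def)

lemma lattice_point_axis: "lattice_point (axis i 1)"
  by (simp add: lattice_point_def axis_def)

lemma lattice_point_zero: "lattice_point 0"
  by (simp add: lattice_point_def)

lemma inner_lattice_point_Ints: "lattice_point x \<Longrightarrow> lattice_point y \<Longrightarrow> inner x y \<in> \<int>"
  by (auto simp: lattice_point_def inner_vec_def)

lemmas lattice_point_intros = lattice_point_add lattice_point_diff lattice_point_scaleR
  lattice_point_axis lattice_point_zero

text \<open>The inverse is carried along so that unimodularity follows from integrality of both
  maps, with no determinant to track at each step.\<close>

definition lattice_iso :: "(real^'n \<Rightarrow> real^'n) \<Rightarrow> (real^'n \<Rightarrow> real^'n) \<Rightarrow> bool" where
  "lattice_iso f g \<longleftrightarrow> linear f \<and> linear g \<and>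
     (\<forall>x. lattice_point x \<longrightarrow> lattice_point (f x) \<and> lattice_point (g x)) \<and>
     (\<forall>x. f (g x) = x \<and> g (f x) = x)"

lemma lattice_iso_sym: "lattice_iso f g \<Longrightarrow> lattice_iso g f"
  by (auto simp: lattice_iso_def)

lemma lattice_iso_comp:
  "lattice_iso f g \<Longrightarrow> lattice_iso f' g' \<Longrightarrow> lattice_iso (f \<circ> f') (g' \<circ> g)"
  by (auto simp: lattice_iso_def intro: linear_compose)

text \<open>Since \<open>w $ j = 0\<close>, coordinate \<open>j\<close> is unchanged and the shear
  can be undone. These are the moves of the Euclidean algorithm.\<close>

lemma lattice_iso_transvection:
  fixes w :: "real^'n"
  assumes "lattice_point w" "w $ j = 0"
  shows "lattice_iso (\<lambda>x. x + x $ j *\<^sub>R w) (\<lambda>x. x - x $ j *\<^sub>R w)"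
proof -
  have "linear (\<lambda>x. x + x $ j *\<^sub>R w)" "linear (\<lambda>x. x - x $ j *\<^sub>R w)"
    by (auto intro!: linearI simp: algebra_simps)
  then show ?thesis
    using assms unfolding lattice_iso_def
    by (auto intro!: lattice_point_intros simp: lattice_point_def)
qed

text \<open>This sends \<open>axis k 1\<close> to \<open>y\<close> and fixes the other axes.
  Coordinate \<open>k\<close> is scaled by \<open>y $ k\<close>, which is 1 or -1 and so its own
  reciprocal; hence the factor in the inverse.\<close>

lemma lattice_iso_replace_axis:
  fixes y :: "real^'n"
  assumes "lattice_point y" "y $ k * y $ k = 1"
  shows "lattice_iso (\<lambda>x. x + x $ k *\<^sub>R (y - axis k 1)) (\<lambda>x. x - (x $ k * y $ k) *\<^sub>R (y - axis k 1))"
proof -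
  have "linear (\<lambda>x. x + x $ k *\<^sub>R (y - axis k 1))"
    "linear (\<lambda>x. x - (x $ k * y $ k) *\<^sub>R (y - axis k 1))"
    by (auto intro!: linearI simp: algebra_simps)
  moreover have "x $ k * y $ k * y $ k = x $ k" for x
    using assms(2) by (simp add: mult.assoc)
  ultimately show ?thesis
    using assms unfolding lattice_iso_def
    by (auto intro!: lattice_point_intros simp: algebra_simps)
      (auto simp: lattice_point_def)
qed

lemma lattice_iso_det:
  fixes f :: "real^'n \<Rightarrow> real^'n"
  assumes "lattice_iso f g"
  shows "\<bar>det (matrix f)\<bar> = 1"
proof -
  have int: "det (matrix h) \<in> \<int>" if "\<forall>x. lattice_point x \<longrightarrow> lattice_point (h x)" for h :: "real^'n \<Rightarrow> real^'n"
    using that lattice_point_axis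
    by (auto simp: det_def matrix_def lattice_point_def intro!: Ints_sum Ints_mult Ints_prod)
  have "matrix f ** matrix g = mat 1"
    using assms unfolding lattice_iso_def
    by (metis (no_types, lifting) comp_apply eq_id_iff ext matrix_compose matrix_id_mat_1)
  then have "det (matrix f) * det (matrix g) = 1"
    by (metis det_I det_mul)
  moreover obtain p q :: int where "det (matrix f) = p" "det (matrix g) = q"
    using int assms unfolding lattice_iso_def by (metis Ints_cases)
  ultimately have "p * q = 1"
    by (metis of_int_1 of_int_eq_iff of_int_mult)
  then have "\<bar>p\<bar> = 1"
    by (simp add: zmult_eq_1_iff) auto
  then show ?thesis
    using \<open>det (matrix f) = p\<close> by linarith
qed

text \<open>Euclid's algorithm on the coordinates of \<open>y\<close> outside \<open>T\<close>; the vector \<open>z\<close> certifies that they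
  are coprime.\<close>

lemma lattice_iso_complete_axis:
  fixes y z :: "real^'n"
  assumes "lattice_point y" "lattice_point z" "inner y z = 1" "\<forall>i\<in>T. z $ i = 0" "k \<notin> T"
  shows "\<exists>f g. lattice_iso f g \<and> f (axis k 1) = y \<and> (\<forall>i\<in>T. f (axis i 1) = axis i 1)"
  using assms
proof (induction "nat (floor (\<Sum>i\<in>-T. \<bar>y $ i\<bar>))" arbitrary: y z rule: less_induct)
  case less
  show ?case
  proof (cases "\<exists>i j. i \<notin> T \<and> j \<notin> T \<and> i \<noteq> j \<and> y $ i \<noteq> 0 \<and> y $ j \<noteq> 0")
    case True
    then obtain i j where ij: "i \<notin> T" "j \<notin> T" "i \<noteq> j" "y $ i \<noteq> 0" "y $ j \<noteq> 0" "\<bar>y $ j\<bar> \<le> \<bar>y $ i\<bar>"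
      by (metis linear)
    \<comment> \<open>With this sign, subtracting \<open>\<sigma> * y $ j\<close> from entry
      \<open>i\<close> lowers its absolute value by exactly that of entry \<open>j\<close>.\<close>
    define \<sigma> where "\<sigma> = sgn (y $ i) * sgn (y $ j)"
    have \<sigma>: "\<sigma> \<in> \<int>"
      by (auto simp: \<sigma>_def sgn_if)
    define w :: "real^'n" where "w = - \<sigma> *\<^sub>R axis i 1"
    define y' where "y' = y + y $ j *\<^sub>R w"
    \<comment> \<open>The certificate changes contragrediently, so its inner product with the new
      vector stays 1; \<open>j \<notin> T\<close> keeps it zero on \<open>T\<close>.\<close>
    define z' where "z' = z + (\<sigma> * z $ i) *\<^sub>R axis j 1"
    have w: "lattice_point w" "w $ j = 0"
      using \<sigma> ij by (auto simp: w_def lattice_point_def axis_def)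
    note E = lattice_iso_transvection[OF w]
    have y': "lattice_point y'"
      using E less.prems(1) by (auto simp: lattice_iso_def y'_def)
    have z': "lattice_point z'"
      using \<sigma> less.prems(2) by (auto simp: z'_def lattice_point_def axis_def)
    have yi: "\<bar>y' $ i\<bar> = \<bar>y $ i\<bar> - \<bar>y $ j\<bar>"
      using ij by (auto simp: y'_def w_def \<sigma>_def axis_def sgn_if split: if_splits)
    have yl: "y' $ l = y $ l" if "l \<noteq> i" for l
      using that by (auto simp: y'_def w_def axis_def)
    have sum_eq: "(\<Sum>l\<in>-T. \<bar>v $ l\<bar>) = \<bar>v $ i\<bar> + (\<Sum>l\<in>-T-{i}. \<bar>v $ l\<bar>)" for v :: "real^'n"
      using ij by (simp add: sum.remove[of "-T" i])
    have "(\<Sum>l\<in>-T. \<bar>y' $ l\<bar>) = (\<Sum>l\<in>-T. \<bar>y $ l\<bar>) - \<bar>y $ j\<bar>"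
      unfolding sum_eq yi by (simp add: yl)
    moreover have "\<bar>y $ j\<bar> \<ge> 1"
      using less.prems(1) ij by (metis Ints_nonzero_abs_ge1 lattice_point_def)
    moreover have "0 \<le> (\<Sum>l\<in>-T. \<bar>y' $ l\<bar>)"
      by (simp add: sum_nonneg)
    ultimately have dec: "nat \<lfloor>\<Sum>l\<in>-T. \<bar>y' $ l\<bar>\<rfloor> < nat \<lfloor>\<Sum>l\<in>-T. \<bar>y $ l\<bar>\<rfloor>"
      by linarith
    have "inner y' z' = inner y z + y $ j * inner w z + (\<sigma> * z $ i) * y' $ j"
      by (simp add: y'_def z'_def inner_add_left inner_add_right inner_axis algebra_simps)
    also have "\<dots> = 1"
      using less.prems(3) ij yl[of j] by (simp add: w_def inner_axis' algebra_simps)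
    finally have "inner y' z' = 1" .
    moreover have "\<forall>l\<in>T. z' $ l = 0"
      using less.prems(4) ij by (auto simp: z'_def axis_def)
    ultimately obtain f g where fg: "lattice_iso f g" "f (axis k 1) = y'" "\<forall>i\<in>T. f (axis i 1) = axis i 1"
      using less.hyps[OF dec y' z'] less.prems(5) by blast
    have comp: "lattice_iso ((\<lambda>x. x - x $ j *\<^sub>R w) \<circ> f) (g \<circ> (\<lambda>x. x + x $ j *\<^sub>R w))"
      by (rule lattice_iso_comp[OF lattice_iso_sym[OF E] fg(1)])
    have undo: "y' - y' $ j *\<^sub>R w = y"
      using w by (simp add: y'_def)
    have fix_T: "axis l 1 - axis l 1 $ j *\<^sub>R w = axis l 1" if "l \<in> T" for l
      using that ij by (auto simp: axis_def)
    show ?thesis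
      by (intro exI conjI, rule comp) (simp_all add: fg undo fix_T)
  next
    case False
    have direct: "\<exists>f g. lattice_iso f g \<and> f (axis k 1) = v \<and> (\<forall>i\<in>T. f (axis i 1) = axis i 1)"
      if "lattice_point v" "v $ k * v $ k = 1" for v :: "real^'n"
      by (intro exI conjI, rule lattice_iso_replace_axis[OF that])
        (use less.prems(5) in \<open>auto simp: axis_def\<close>)
    have "\<exists>i. i \<notin> T \<and> y $ i * z $ i \<noteq> 0"
    proof (rule ccontr)
      assume "\<not> ?thesis"
      then have "inner y z = 0"
        using less.prems(4) unfolding inner_vec_def by (intro sum.neutral) auto
      then show False
        using less.prems(3) by simp
    qed
    then obtain i where i: "i \<notin> T" "y $ i \<noteq> 0"
      by auto
    \<comment> \<open>Only coordinate \<open>i\<close> contributes: \<open>z\<close> vanishes on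
      \<open>T\<close>, and \<open>y\<close> has no second nonzero entry outside \<open>T\<close>.
      Hence \<open>y $ i\<close> is a unit.\<close>
    have "inner y z = (\<Sum>l\<in>UNIV. if l = i then y $ i * z $ i else 0)"
      unfolding inner_vec_def using False i less.prems(4) by (intro sum.cong) auto
    then have yz: "y $ i * z $ i = 1"
      using less.prems(3) by simp
    have yy: "y $ i * y $ i = 1"
    proof -
      obtain p q :: int where pq: "y $ i = p" "z $ i = q"
        using less.prems(1,2) by (metis Ints_cases lattice_point_def)
      then have "p * q = 1"
        using yz by (metis of_int_1 of_int_eq_iff of_int_mult)
      then have "p = 1 \<or> p = -1"
        using zmult_eq_1_iff by blast
      then show ?thesis
        using pq by auto
    qed
    show ?thesis
    proof (cases "i = k")
      case True
      then show ?thesis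
        using direct[OF less.prems(1)] yy by simp
    next
      case ik: False
      define w :: "real^'n" where "w = y $ i *\<^sub>R axis k 1"
      have w: "lattice_point w" "w $ i = 0"
        using ik less.prems(1) by (auto simp: w_def lattice_point_def axis_def)
      note E = lattice_iso_transvection[OF w]
      \<comment> \<open>The unit entry at \<open>i\<close> is copied into position \<open>k\<close>,
        where \<open>y\<close> is zero, giving the entry \<open>y $ i * y $ i = 1\<close>.\<close>
      define y' where "y' = y + y $ i *\<^sub>R w"
      have "y $ k = 0"
        using False i ik less.prems(5) by blast
      then have "y' $ k * y' $ k = 1"
        using yy by (simp add: y'_def w_def)
      moreover have "lattice_point y'"
        using E less.prems(1) by (auto simp: lattice_iso_def y'_def)
      ultimately obtain f g where fg: "lattice_iso f g" "f (axis k 1) = y'" "\<forall>i\<in>T. f (axis i 1) = axis i 1"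
        using direct by blast
      have comp: "lattice_iso ((\<lambda>x. x - x $ i *\<^sub>R w) \<circ> f) (g \<circ> (\<lambda>x. x + x $ i *\<^sub>R w))"
        by (rule lattice_iso_comp[OF lattice_iso_sym[OF E] fg(1)])
      have undo: "y' - y' $ i *\<^sub>R w = y"
        using w by (simp add: y'_def)
      have fix_T: "axis l 1 - axis l 1 $ i *\<^sub>R w = axis l 1" if "l \<in> T" for l
        using that i by (auto simp: axis_def)
      show ?thesis
        by (intro exI conjI, rule comp) (simp_all add: fg undo fix_T)
    qed
  qed
qed

text \<open>By induction, \<open>a k\<close> is pulled back through \<open>f\<close> and completed
  by an automorphism fixing the axes already placed. The dual vectors \<open>p\<close> supply the
  coprimality certificates.\<close>

lemma lattice_iso_extend:
  fixes a p :: "'n \<Rightarrow> real^'n"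
  assumes "finite T"
    and "\<And>i. i \<in> T \<Longrightarrow> lattice_point (a i)" "\<And>i. i \<in> T \<Longrightarrow> lattice_point (p i)"
    and "\<And>i j. i \<in> T \<Longrightarrow> j \<in> T \<Longrightarrow> inner (a i) (p j) = (if i = j then 1 else 0)"
  shows "\<exists>f g. lattice_iso f g \<and> (\<forall>i\<in>T. f (axis i 1) = a i)"
  using assms
proof (induction T rule: finite_induct)
  case empty
  have "lattice_iso id id"
    by (auto simp: lattice_iso_def linear_id)
  then show ?case by blast
next
  case (insert k T)
  then obtain f g where fg: "lattice_iso f g" "\<forall>i\<in>T. f (axis i 1) = a i"
    by auto
  have f: "linear f" "\<And>x. lattice_point x \<Longrightarrow> lattice_point (f x)" "\<And>x. f (g x) = x"
    and gl: "\<And>x. lattice_point x \<Longrightarrow> lattice_point (g x)"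
    using fg(1) by (auto simp: lattice_iso_def)
  define y where "y = g (a k)"
  \<comment> \<open>This is the transpose of \<open>f\<close> applied to \<open>p k\<close>; it
    vanishes on \<open>T\<close> because \<open>f\<close> sends those axes to vectors orthogonal to
    \<open>p k\<close>.\<close>
  define z where "z = (\<chi> i. inner (f (axis i 1)) (p k))"
  have y: "lattice_point y"
    using gl insert.prems(1) by (simp add: y_def)
  have z: "lattice_point z"
    unfolding z_def lattice_point_def[of "vec_lambda _"]
    by (simp add: f(2) insert.prems(2) lattice_point_axis inner_lattice_point_Ints)
  have "f y = (\<Sum>i\<in>UNIV. y $ i *\<^sub>R f (axis i 1))"
    by (metis (no_types, lifting) basis_expansion f(1) linear_cmul linear_sum scalar_mult_eq_scaleR sum.cong)
  then have "inner (f y) (p k) = inner y z"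
    by (simp add: inner_sum_left inner_vec_def[of y] z_def)
  then have "inner y z = 1"
    using insert.prems(3)[of k k] by (simp add: y_def f)
  moreover have "\<forall>i\<in>T. z $ i = 0"
    using fg(2) insert.prems(3)[of _ k] insert.hyps by (auto simp: z_def)
  ultimately obtain f' g' where f': "lattice_iso f' g'" "f' (axis k 1) = y"
    "\<forall>i\<in>T. f' (axis i 1) = axis i 1"
    using lattice_iso_complete_axis[OF y z] insert.hyps by blast
  have "lattice_iso (f \<circ> f') (g' \<circ> g)"
    by (rule lattice_iso_comp[OF fg(1) f'(1)])
  then show ?case
    using f' fg f by (intro exI conjI) (auto simp: y_def)
qed

lemma unimodular_matrix_extend:
  fixes a p :: "'n \<Rightarrow> real^'n"
  assumes "\<And>i. i \<in> T \<Longrightarrow> lattice_point (a i)" "\<And>i. i \<in> T \<Longrightarrow> lattice_point (p i)"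
    and "\<And>i j. i \<in> T \<Longrightarrow> j \<in> T \<Longrightarrow> inner (a i) (p j) = (if i = j then 1 else 0)"
  obtains A :: "real^'n^'n" where "\<forall>i j. A $ i $ j \<in> \<int>" "\<bar>det A\<bar> = 1" "\<And>i. i \<in> T \<Longrightarrow> A $ i = a i"
proof -
  obtain f g where fg: "lattice_iso f g" "\<forall>i\<in>T. f (axis i 1) = a i"
    using lattice_iso_extend[of T a p] assms by auto
  define A where "A = (transpose (matrix f) :: real^'n^'n)"
  have A: "A $ i = f (axis i 1)" for i
    by (simp add: A_def transpose_def matrix_def vec_eq_iff)
  show ?thesis
  proof
    show "\<forall>i j. A $ i $ j \<in> \<int>"
      using fg(1) lattice_point_axis unfolding A lattice_iso_def by (metis lattice_point_def)
    show "\<bar>det A\<bar> = 1"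
      unfolding A_def det_transpose by (rule lattice_iso_det[OF fg(1)])
    show "A $ i = a i" if "i \<in> T" for i
      using that fg(2) A by simp
  qed
qed

section \<open>Cayley sums\<close>

lemma lattice_polytope_convex_hull:
  "finite S \<Longrightarrow> S \<noteq> {} \<Longrightarrow> (\<And>x. x \<in> S \<Longrightarrow> lattice_point x) \<Longrightarrow> lattice_polytope (convex hull S)"
  unfolding lattice_polytope_def by blast

lemma convex_hull_affine_matrix_image:
  fixes A :: "real^'n^'m"
  shows "(\<lambda>x. A *v x + b) ` (convex hull S) = convex hull ((\<lambda>x. A *v x + b) ` S)"
proof -
  have "(\<lambda>x. A *v x + b) ` V = (\<lambda>x. b + x) ` ((*v) A ` V)" for V
    by (auto simp: image_image add.commute)
  then show ?thesis
    by (simp add: convex_hull_linear_image convex_hull_translation)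
qed

lemma in_base_space_convex_hull:
  fixes S :: "(real^'n) set"
  assumes "in_base_space T S"
  shows "in_base_space T (convex hull S)"
proof -
  have "convex {x :: real^'n. \<forall>i\<in>T. x $ i = 0}" for T
    by (auto simp: convex_def)
  then show ?thesis
    using assms hull_minimal[of S "{x. \<forall>i\<in>T. x $ i = 0}" convex]
    by (auto simp: in_base_space_def)
qed

lemma cayley_sum_convex_hull:
  "cayley_sum T (convex hull V) (\<lambda>j. convex hull W j) =
     convex hull (V \<union> (\<Union>j\<in>T. (\<lambda>x. x + axis j 1) ` W j))"
proof -
  have *: "(\<lambda>x. x + axis j 1) ` (convex hull W j) = convex hull ((\<lambda>x. x + axis j 1) ` W j)" for j
    using convex_hull_translation[of "axis j 1" "W j"] by (simp add: add.commute)
  have "convex hull (convex hull V \<union> (\<Union>j\<in>T. convex hull ((\<lambda>x. x + axis j 1) ` W j))) =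
     convex hull (V \<union> (\<Union>j\<in>T. (\<lambda>x. x + axis j 1) ` W j))" (is "?l = ?r")
  proof (rule antisym)
    show "?l \<subseteq> ?r"
      by (intro hull_minimal Un_least UN_least hull_mono convex_convex_hull) blast+
    show "?r \<subseteq> ?l"
      by (intro hull_mono Un_mono UN_mono hull_subset order_refl)
  qed
  then show ?thesis
    by (simp add: cayley_sum_def *)
qed

text \<open>Affine functions are pairs of linear part and constant, so that they form a Euclidean
  space in which independence, convex hulls and separation are available.\<close>

definition aff_eval :: "(real^'n) \<times> real \<Rightarrow> real^'n \<Rightarrow> real" where
  "aff_eval w x = inner (fst w) x + snd w"

definition lattice_aff :: "(real^'n) \<times> real \<Rightarrow> bool" where
  "lattice_aff w \<longleftrightarrow> lattice_point (fst w) \<and> snd w \<in> \<int>"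

text \<open>The functions \<open>h i\<close> become the coordinates in \<open>T\<close>; then every
  point of \<open>S\<close> lies over 0 or over a unit vector, and these fibres generate the
  summands. The class of \<open>w0\<close> is the fibre over 0.\<close>

lemma cayley_sum_of_partition:
  fixes S :: "(real^'n) set" and J :: "((real^'n) \<times> real) set"
  assumes S: "finite S" "\<And>s. s \<in> S \<Longrightarrow> lattice_point s"
    and J: "\<And>w. w \<in> J \<Longrightarrow> lattice_aff w"
    and part: "\<And>s. s \<in> S \<Longrightarrow> \<exists>w\<in>J. aff_eval w s = 1 \<and> (\<forall>w'\<in>J. w' \<noteq> w \<longrightarrow> aff_eval w' s = 0)"
    and ne: "\<And>w. w \<in> J \<Longrightarrow> \<exists>s\<in>S. aff_eval w s = 1"
    and w0: "w0 \<in> J" and h: "bij_betw h T (J - {w0})"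
  shows "\<exists>P0 Q. lattice_polytope P0 \<and> in_base_space T P0 \<and>
     (\<forall>j\<in>T. lattice_polytope (Q j) \<and> in_base_space T (Q j)) \<and>
     unimod_equiv (convex hull S) (cayley_sum T P0 Q)"
proof -
  have hJ: "h i \<in> J" "h i \<noteq> w0" if "i \<in> T" for i
    using h that by (auto simp: bij_betw_def)
  have hinj: "h i = h j \<longleftrightarrow> i = j" if "i \<in> T" "j \<in> T" for i j
    using h that by (auto simp: bij_betw_def inj_on_def)
  have uniq: "aff_eval w' s = 0" if "s \<in> S" "w \<in> J" "w' \<in> J" "w \<noteq> w'" "aff_eval w s = 1" for s w w'
    using part[OF that(1)] that by (metis zero_neq_one)
  obtain v where v: "\<And>w. w \<in> J \<Longrightarrow> v w \<in> S" "\<And>w. w \<in> J \<Longrightarrow> aff_eval w (v w) = 1"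
    using ne by metis
  have eval: "aff_eval w (v w') = (if w = w' then 1 else 0)" if "w \<in> J" "w' \<in> J" for w w'
    using uniq[OF v(1) that(2,1) _ v(2)] v(2) that by (cases "w = w'") simp_all
  \<comment> \<open>Differences of class representatives are dual to the linear parts: the constants
    cancel and the representative of \<open>w0\<close> contributes zero.\<close>
  define a where "a = (\<lambda>i. fst (h i))"
  define p where "p = (\<lambda>i. v (h i) - v w0)"
  have "inner (a i) (p j) = (if i = j then 1 else 0)" if "i \<in> T" "j \<in> T" for i j
  proof -
    have "inner (a i) (p j) = aff_eval (h i) (v (h j)) - aff_eval (h i) (v w0)"
      by (simp add: a_def p_def aff_eval_def inner_diff_right)
    then show ?thesis
      by (simp add: eval hJ that w0 hinj)
  qed
  moreover have "lattice_point (a i)" "lattice_point (p i)" if "i \<in> T" for i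
    using J[unfolded lattice_aff_def] S(2) v(1) hJ that w0
    by (simp_all add: a_def p_def lattice_point_diff)
  ultimately obtain A :: "real^'n^'n" where A: "\<forall>i j. A $ i $ j \<in> \<int>" "\<bar>det A\<bar> = 1"
      "\<And>i. i \<in> T \<Longrightarrow> A $ i = a i"
    using unimodular_matrix_extend[of T a p] by blast
  \<comment> \<open>The constants enter the translation, so coordinate \<open>i\<close> of
    \<open>f x\<close> is the full affine value of \<open>h i\<close> at \<open>x\<close>.\<close>
  define b :: "real^'n" where "b = (\<chi> i. if i \<in> T then snd (h i) else 0)"
  define f where "f = (\<lambda>x. A *v x + b)"
  have b: "lattice_point b"
    using J[unfolded lattice_aff_def] hJ by (simp add: b_def lattice_point_def)
  then have f_aut: "affine_lattice_aut f"
    using A unfolding affine_lattice_aut_def f_def by blast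
  have fT: "f x $ i = aff_eval (h i) x" if "i \<in> T" for x i
    using A(3)[OF that] that
    by (simp add: f_def b_def a_def aff_eval_def matrix_vector_mul_component)
  have f_lattice: "lattice_point (f x)" if "lattice_point x" for x
    using that A(1) b
    by (auto simp: f_def lattice_point_def matrix_vector_mult_def intro!: Ints_add Ints_sum Ints_mult)
  \<comment> \<open>These are the fibres over 0 and over \<open>axis j 1\<close>, the latter
    translated back into the base space.\<close>
  define V where "V = f ` {s\<in>S. aff_eval w0 s = 1}"
  define W where "W = (\<lambda>j. (\<lambda>s. f s - axis j 1) ` {s\<in>S. aff_eval (h j) s = 1})"
  have V: "in_base_space T V"
    unfolding in_base_space_def
  proof (intro ballI)
    fix x i assume "x \<in> V" "i \<in> T"
    then show "x $ i = 0"
      using uniq[OF _ w0 hJ(1)[OF \<open>i \<in> T\<close>] hJ(2)[OF \<open>i \<in> T\<close>, symmetric]] by (auto simp: V_def fT)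
  qed
  have W: "in_base_space T (W j)" if "j \<in> T" for j
    unfolding in_base_space_def
  proof (intro ballI)
    fix x i assume "x \<in> W j" "i \<in> T"
    then obtain s where s: "s \<in> S" "aff_eval (h j) s = 1" "x = f s - axis j 1"
      by (auto simp: W_def)
    show "x $ i = 0"
    proof (cases "i = j")
      case True
      then show ?thesis
        using s that by (simp add: fT)
    next
      case False
      then have "aff_eval (h i) s = 0"
        using uniq[OF s(1) hJ(1)[OF that] hJ(1)[OF \<open>i \<in> T\<close>] _ s(2)] hinj[OF that \<open>i \<in> T\<close>] by simp
      then show ?thesis
        using False s \<open>i \<in> T\<close> by (simp add: fT axis_def)
    qed
  qed
  have lattice_V: "lattice_polytope (convex hull V)"
  proof (rule lattice_polytope_convex_hull)
    show "finite V" "V \<noteq> {}"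
      using S v[OF w0] by (auto simp: V_def)
    show "lattice_point x" if "x \<in> V" for x
      using that S f_lattice by (auto simp: V_def)
  qed
  have lattice_W: "lattice_polytope (convex hull W j)" if "j \<in> T" for j
  proof (rule lattice_polytope_convex_hull)
    show "finite (W j)" "W j \<noteq> {}"
      using S v[OF hJ(1)[OF that]] by (auto simp: W_def)
    show "lattice_point x" if "x \<in> W j" for x
      using that S f_lattice by (auto simp: W_def intro!: lattice_point_diff lattice_point_axis)
  qed
  have f_hull: "f ` (convex hull S) = convex hull (f ` S)"
    unfolding f_def by (rule convex_hull_affine_matrix_image)
  have "f ` S = V \<union> (\<Union>j\<in>T. (\<lambda>x. x + axis j 1) ` W j)"
  proof -
    have W_eq: "(\<lambda>x. x + axis j 1) ` W j = f ` {s\<in>S. aff_eval (h j) s = 1}" for j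
      by (simp add: W_def image_image)
    have "\<exists>j\<in>T. aff_eval (h j) s = 1" if s: "s \<in> S" "aff_eval w0 s \<noteq> 1" for s
    proof -
      obtain w where "w \<in> J - {w0}" "aff_eval w s = 1"
        using part[OF s(1)] s(2) by blast
      then have "w \<in> h ` T"
        using bij_betw_imp_surj_on[OF h] by simp
      then show ?thesis
        using \<open>aff_eval w s = 1\<close> by auto
    qed
    then have "S = {s\<in>S. aff_eval w0 s = 1} \<union> (\<Union>j\<in>T. {s\<in>S. aff_eval (h j) s = 1})"
      by auto
    then have "f ` S = f ` ({s\<in>S. aff_eval w0 s = 1} \<union> (\<Union>j\<in>T. {s\<in>S. aff_eval (h j) s = 1}))"
      by (rule arg_cong)
    then show ?thesis
      by (simp only: V_def W_eq image_Un image_UN)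
  qed
  then have "f ` (convex hull S) = cayley_sum T (convex hull V) (\<lambda>j. convex hull W j)"
    by (simp only: f_hull cayley_sum_convex_hull)
  then have "unimod_equiv (convex hull S) (cayley_sum T (convex hull V) (\<lambda>j. convex hull W j))"
    unfolding unimod_equiv_def using f_aut by blast
  then show ?thesis
    by (intro exI[of _ "convex hull V"] exI[of _ "\<lambda>j. convex hull W j"])
      (simp add: lattice_V lattice_W in_base_space_convex_hull V W)
qed

text \<open>When \<open>T\<close> contains every coordinate, the base space is a point, so each
  summand is the origin.\<close>

lemma cayley_sum_points_eq_unimodular_simplex:
  assumes "lattice_polytope P0" "in_base_space UNIV P0"
    "\<And>j. lattice_polytope (Q j) \<and> in_base_space UNIV (Q j)"
  shows "cayley_sum UNIV P0 Q = unimodular_simplex"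
proof -
  have "R = {0}" if "lattice_polytope R" "in_base_space UNIV R" for R :: "(real^'n) set"
  proof (rule subset_singleton_iff[THEN iffD1, THEN disjE])
    show "R \<subseteq> {0}"
      using that by (auto simp: in_base_space_def vec_eq_iff)
    show "R = {0}" if "R = {}"
      using that \<open>lattice_polytope R\<close> by (simp add: lattice_polytope_def) (metis convex_hull_eq_empty)
  qed
  then have "P0 = {0}" "Q = (\<lambda>_. {0})"
    using assms by blast+
  then show ?thesis
    by (simp add: cayley_sum_def unimodular_simplex_def UNION_singleton_eq_range)
qed

section \<open>Facets of lattice polytopes\<close>

text \<open>The coefficients of \<open>det M(x)\<close> in \<open>x\<close>, where \<open>M(x)\<close> has \<open>x\<close> in one row and the
  elements of \<open>B\<close> in the others, are integers and give a vector orthogonal to \<open>B\<close>.\<close>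

lemma lattice_normal_exists:
  fixes B :: "(real^'n) set"
  assumes indep: "independent B" and card: "card B = CARD('n) - 1"
    and lattice: "\<And>d. d \<in> B \<Longrightarrow> lattice_point d"
  obtains a where "a \<noteq> 0" "lattice_point a" "\<And>d. d \<in> B \<Longrightarrow> inner a d = 0"
proof -
  define k :: 'n where "k = undefined"
  have "finite B"
    using indep independent_imp_finite by blast
  then obtain h where h: "bij_betw h (UNIV - {k}) B"
    by (metis card card_Diff_singleton finite finite_same_card_bij iso_tuple_UNIV_I)
  define M where "M = (\<lambda>x. (\<chi> r. if r = k then x else h r) :: real^'n^'n)"
  define a where "a = (\<chi> i. det (M (axis i 1)))"
  have det_eq: "det (M x) = inner a x" for x
  proof -
    have "M x = (\<chi> r. if r = k then sum (\<lambda>i. x $ i *s axis i 1) UNIV else h r)"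
      by (simp only: M_def basis_expansion)
    also have "det \<dots> = (\<Sum>i\<in>UNIV. x $ i * det (M (axis i 1)))"
      unfolding M_def
      by (simp add: det_linear_row_sum[where a="\<lambda>_ i. x $ i *s axis i 1"]
          det_row_mul[where a="\<lambda>_. axis _ 1"])
    finally show ?thesis
      by (simp add: a_def inner_vec_def mult.commute)
  qed
  have orth: "inner a d = 0" if d: "d \<in> B" for d
  proof -
    obtain r where r: "r \<noteq> k" "d = h r"
      using d bij_betw_imp_surj_on[OF h] by blast
    have "det (M d) = 0"
      by (rule det_identical_rows[OF r(1)]) (simp add: row_def M_def r vec_eq_iff)
    then show ?thesis
      by (simp add: det_eq)
  qed
  have "lattice_point (M (axis i 1) $ r)" for i r
    using h lattice lattice_point_axis by (auto simp: M_def bij_betw_def)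
  then have "lattice_point a"
    unfolding a_def lattice_point_def det_def
    by (auto intro!: Ints_sum Ints_mult Ints_prod)
  moreover have "a \<noteq> 0"
  proof
    \<comment> \<open>A zero vector would make \<open>det (M x)\<close> vanish for every
      \<open>x\<close>, whereas an \<open>x\<close> outside the span of \<open>B\<close> gives
      independent rows.\<close>
    assume "a = 0"
    have "dim B < CARD('n)"
      using indep card by (simp add: dim_eq_card_independent)
    then have "span B \<noteq> UNIV"
      by (metis DIM_cart DIM_real dim_span dim_UNIV less_irrefl mult.right_neutral)
    then obtain x where x: "x \<notin> span B"
      by auto
    define H where "H = (\<lambda>r. if r = k then x else h r)"
    have H: "inj H" "range H = insert x B"
      using h x span_superset[of B] by (auto simp: H_def inj_def bij_betw_def inj_on_def)
    have ind: "independent (range H)"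
      using indep x H(2) by (simp add: independent_insertI)
    have "c i = 0" if "(\<Sum>i\<in>UNIV. c i *s row i (M x)) = 0" for c i
    proof -
      have "(\<Sum>v\<in>range H. c (inv H v) *\<^sub>R v) = (\<Sum>i\<in>UNIV. c i *\<^sub>R H i)"
        using H(1) by (simp add: sum.reindex)
      also have "\<dots> = (\<Sum>i\<in>UNIV. c i *s row i (M x))"
        by (intro sum.cong) (auto simp: H_def M_def row_def scalar_mult_eq_scaleR vec_lambda_eta)
      finally have "(\<Sum>v\<in>range H. c (inv H v) *\<^sub>R v) = 0"
        using that by simp
      then have "c (inv H (H i)) = 0"
        using independentD[OF ind, of "range H" "\<lambda>v. c (inv H v)" "H i"] by simp
      then show ?thesis
        using H(1) by simp
    qed
    then have "\<exists>C. M x ** C = mat 1"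
      using matrix_right_invertible_independent_rows by blast
    then have "det (M x) \<noteq> 0"
      by (metis det_I det_mul mult_zero_left zero_neq_one)
    then show False
      using det_eq \<open>a = 0\<close> by simp
  qed
  ultimately show ?thesis
    using that orth by blast
qed

section \<open>Primitive integer vectors\<close>

lemma lattice_point_of_int:
  assumes "lattice_point a"
  shows "\<exists>z. \<forall>i. a $ i = real_of_int (z i)"
proof -
  have "\<forall>i. \<exists>z. a $ i = real_of_int z"
    using assms by (auto simp: lattice_point_def elim: Ints_cases)
  then show ?thesis
    by (rule choice)
qed

lemma primitive_multiple_exists:
  fixes a :: "real^'n"
  assumes "lattice_point a" "a \<noteq> 0"
  obtains g :: real where "g > 0" "primitive (inverse g *\<^sub>R a)"
proof -
  obtain z :: "'n \<Rightarrow> int" where z: "\<And>i. a $ i = z i"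
    using lattice_point_of_int[OF assms(1)] by metis
  define g where "g = Gcd (range z)"
  have gdvd: "g dvd z i" for i
    by (simp add: g_def)
  obtain i0 where i0: "z i0 \<noteq> 0"
    using assms(2) z by (metis of_int_0 vec_eq_iff zero_index)
  then have "g \<noteq> 0"
    using gdvd by auto
  then have g: "g > 0"
    by (metis Gcd_int_greater_eq_0 g_def order_le_less)
  have val: "(inverse (of_int g) *\<^sub>R a) $ i = of_int (z i div g)" for i
    using gdvd[of i] g by (auto simp: z field_simps elim!: dvdE)
  have "primitive (inverse (of_int g) *\<^sub>R a)"
    unfolding primitive_def
  proof (intro conjI allI impI)
    show "lattice_point (inverse (of_int g) *\<^sub>R a)"
      unfolding lattice_point_def val by simp
    show "inverse (of_int g) *\<^sub>R a \<noteq> 0"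
      using assms g by simp
    fix k :: int
    assume k: "0 < k \<and> (\<forall>i. \<exists>y. (inverse (of_int g) *\<^sub>R a) $ i = real_of_int k * real_of_int y)"
    have "g * k dvd z i" for i
    proof -
      obtain y where "(inverse (of_int g) *\<^sub>R a) $ i = real_of_int k * real_of_int y"
        using k by blast
      then have "z i div g = k * y"
        unfolding val by (metis of_int_eq_iff of_int_mult)
      then have "z i = g * k * y"
        using gdvd[of i] by (metis dvd_mult_div_cancel mult.assoc)
      then show ?thesis
        by simp
    qed
    then have "g * k dvd Gcd (range z)"
      by (intro Gcd_greatest) blast
    then have "g * k dvd g"
      by (simp only: g_def[symmetric])
    then show "k = 1"
      using g k by (metis dvd_mult_cancel_left mult.right_neutral zdvd1_eq abs_of_pos less_irrefl)
  qed
  then show ?thesis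
    using that[of "of_int g"] g by simp
qed

text \<open>Write \<open>c\<close> in lowest terms as \<open>q / p\<close>. Then \<open>p\<close>
  divides every coordinate of \<open>a\<close> and \<open>q\<close> every coordinate of
  \<open>a'\<close>, and primitivity makes both units.\<close>

lemma primitive_parallel_eq:
  fixes a a' :: "real^'n"
  assumes "primitive a" "primitive a'" "c > 0" "a' = c *\<^sub>R a"
  shows "a' = a"
proof -
  obtain z :: "'n \<Rightarrow> int" where z: "\<And>i. a $ i = z i"
    using assms(1) lattice_point_of_int unfolding primitive_def by metis
  obtain z' :: "'n \<Rightarrow> int" where z': "\<And>i. a' $ i = z' i"
    using assms(2) lattice_point_of_int unfolding primitive_def by metis
  obtain i0 where i0: "z i0 \<noteq> 0"
    using assms(1) z unfolding primitive_def by (metis of_int_0 vec_eq_iff zero_index)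
  have c: "real_of_int (z' i) = c * z i" for i
    using assms(4) z z' by (metis vector_scaleR_component real_scaleR_def)
  obtain g p q where gpq: "z i0 = g * p" "z' i0 = g * q" "coprime p q" "g \<noteq> 0"
  proof -
    have "gcd (z i0) (z' i0) \<noteq> 0"
      using i0 by simp
    then show ?thesis
      using that gcd_coprime_exists[of "z i0" "z' i0"] by (metis mult.commute)
  qed
  have cross: "z' i * p = q * z i" for i
  proof -
    have "real_of_int (z' i) * z i0 = z' i0 * z i"
      by (simp add: c)
    then have "z' i * z i0 = z' i0 * z i"
      by (metis of_int_eq_iff of_int_mult)
    then show ?thesis
      using gpq by (simp add: mult.assoc mult.left_commute)
  qed
  have unit: "\<bar>k\<bar> = 1" if "\<And>i. k dvd y i" "k \<noteq> 0" "primitive v" "\<And>i. v $ i = real_of_int (y i)"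
    for k :: int and y v
  proof -
    have "\<exists>x. v $ i = real_of_int \<bar>k\<bar> * real_of_int x" for i
    proof -
      have "\<bar>k\<bar> dvd y i"
        using that(1) by simp
      then obtain x where "y i = \<bar>k\<bar> * x" ..
      then show ?thesis
        using that(4)[of i] by (intro exI[of _ x]) (simp only: of_int_mult)
    qed
    then show ?thesis
      using that(2,3) unfolding primitive_def by (metis zero_less_abs_iff)
  qed
  have "p dvd z i" for i
    using cross[of i] gpq(3) by (metis coprime_dvd_mult_right_iff dvd_triv_right)
  then have p: "\<bar>p\<bar> = 1"
    using unit[of p z a] i0 gpq assms(1) z by auto
  have "q dvd z' i" for i
    using cross[of i] gpq(3) by (metis coprime_commute coprime_dvd_mult_left_iff dvd_triv_left)
  moreover have "q \<noteq> 0"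
    using c[of i0] gpq i0 assms(3) by auto
  ultimately have q: "\<bar>q\<bar> = 1"
    using unit[of q z' a'] assms(2) z' by auto
  have "real_of_int q = c * p"
    using c[of i0] gpq by simp
  then have "\<bar>c\<bar> = 1"
    using p q by (metis abs_mult mult.right_neutral of_int_1 of_int_abs)
  then show ?thesis
    using assms(3,4) by simp
qed

section \<open>Hyperplanes and normals of facets\<close>

lemma facet_affine_hull:
  fixes P :: "(real^'n) set"
  assumes "F facet_of P" "aff_dim P = int CARD('n)" "a \<noteq> 0" "\<forall>y\<in>F. inner a y = b"
  shows "affine hull F = {y. inner a y = b}"
proof (rule affine_dim_equal)
  show "affine hull F \<subseteq> {y. inner a y = b}"
    by (rule hull_minimal) (use assms affine_hyperplane in auto)
  show "aff_dim (affine hull F) = aff_dim {y. inner a y = b}"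
    using assms by (simp add: facet_of_def aff_dim_hyperplane)
  show "affine hull F \<noteq> {}"
    using assms by (simp add: facet_of_def)
qed (auto simp: affine_hyperplane)

text \<open>Both hyperplanes equal the affine hull of the facet. The component of \<open>a'\<close>
  orthogonal to \<open>a\<close> moves within that hyperplane, so it is also orthogonal to
  \<open>a'\<close> and hence zero.\<close>

lemma facet_normals_proportional:
  fixes P :: "(real^'n) set"
  assumes "F facet_of P" "aff_dim P = int CARD('n)"
    and "a \<noteq> 0" "\<forall>y\<in>F. inner a y = b" "a' \<noteq> 0" "\<forall>y\<in>F. inner a' y = b'"
  obtains c where "c \<noteq> 0" "a' = c *\<^sub>R a"
proof -
  have eq: "{y. inner a y = b} = {y. inner a' y = b'}"
    using facet_affine_hull[OF assms(1,2)] assms(3-6) by metis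
  obtain f where f: "inner a f = b" "inner a' f = b'"
    using assms by (metis facet_of_def all_not_in_conv)
  define c where "c = inner a a' / inner a a"
  define y where "y = a' - c *\<^sub>R a"
  have ay: "inner a y = 0"
    using assms(3) by (simp add: y_def c_def inner_diff_right)
  then have "f + y \<in> {y. inner a y = b}"
    using f by (simp add: inner_add_right)
  then have "inner a' y = 0"
    using f by (simp add: eq inner_add_right)
  then have "inner y y = 0"
    using ay by (simp add: y_def inner_diff_left)
  then have "a' = c *\<^sub>R a"
    by (simp add: y_def)
  then show ?thesis
    using that assms(5) by auto
qed

text \<open>Some point of the full-dimensional \<open>P\<close> lies strictly above the hyperplane;
  both inequalities hold there, which fixes the sign.\<close>

lemma facet_normals_proportional_pos:
  fixes P :: "(real^'n) set"
  assumes "F facet_of P" "aff_dim P = int CARD('n)"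
    and "a \<noteq> 0" "\<forall>y\<in>F. inner a y = b" "\<forall>y\<in>P. inner a y \<ge> b"
    and "a' \<noteq> 0" "\<forall>y\<in>F. inner a' y = b'" "\<forall>y\<in>P. inner a' y \<ge> b'"
  obtains c where "c > 0" "a' = c *\<^sub>R a"
proof -
  obtain c where c: "c \<noteq> 0" "a' = c *\<^sub>R a"
    using facet_normals_proportional[OF assms(1-4,6,7)] .
  obtain f where f: "f \<in> F"
    using assms by (metis facet_of_def all_not_in_conv)
  have "\<not> P \<subseteq> {y. inner a y = b}"
    using assms(2,3) aff_dim_subset[of P "{y. inner a y = b}"] by (auto simp: aff_dim_hyperplane)
  then obtain y where y: "y \<in> P" "inner a y > b"
    using assms(5) by force
  have "inner a' y - b' = c * (inner a y - b)"
    using assms(4,7) f c by (auto simp: algebra_simps)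
  moreover have "inner a' y - b' \<ge> 0"
    using assms(8) y by simp
  ultimately have "c \<ge> 0"
    using y by (metis diff_gt_0_iff_gt mult_less_0_iff not_le)
  with c(1) have "c > 0"
    by simp
  then show ?thesis
    using that c(2) by blast
qed

text \<open>\<open>S\<close> is any finite set of lattice points with hull \<open>P\<close>; its
  points need not be vertices.\<close>

locale full_lattice_polytope =
  fixes S P :: "(real^'n) set"
  assumes finite_S: "finite S" and lattice_S: "\<And>s. s \<in> S \<Longrightarrow> lattice_point s"
    and P_eq: "P = convex hull S" and full_dim: "aff_dim P = int CARD('n)"
begin

lemma polytope_P: "polytope P"
  using finite_S P_eq polytope_convex_hull by blast

lemma S_subset_P: "S \<subseteq> P"
  by (simp add: P_eq hull_subset)

lemma affine_hull_P: "affine hull P = UNIV"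
  using full_dim by (simp add: aff_dim_eq_full[symmetric])

lemma facet_vertices:
  assumes "F facet_of P"
  obtains S' where "S' \<subseteq> S" "S' \<noteq> {}" "F = convex hull S'"
  using assms face_of_convex_hull_subset[of S F] finite_S
  unfolding facet_of_def P_eq by (metis convex_hull_eq_empty finite_imp_compact)

text \<open>A functional exposing the facet is only real. Lattice points affinely spanning the facet
  yield an integer normal proportional to it, which is then turned inward and divided by its common
  factor.\<close>

lemma facet_ineq_exists:
  assumes F: "F facet_of P"
  obtains a b where "facet_ineq P a b" "\<forall>y\<in>F. inner a y = b"
proof -
  have "F exposed_face_of P"
    using F polytope_P by (simp add: exposed_face_of_polyhedron polytope_imp_polyhedron facet_of_imp_face_of)
  then obtain n0 \<beta>0 where n0: "P \<subseteq> {x. inner n0 x \<le> \<beta>0}" "F = P \<inter> {x. inner n0 x = \<beta>0}"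
    unfolding exposed_face_of_def by blast
  have F_dim: "aff_dim F = int CARD('n) - 1" "F \<noteq> {}"
    using F full_dim by (auto simp: facet_of_def)
  have "n0 \<noteq> 0"
  proof
    assume "n0 = 0"
    then have "F = P"
      using n0 F_dim by auto
    then show False
      using F_dim full_dim by simp
  qed
  obtain S' where S': "S' \<subseteq> S" "S' \<noteq> {}" "F = convex hull S'"
    using facet_vertices[OF F] .
  obtain B where B: "B \<subseteq> S'" "\<not> affine_dependent B" "affine hull S' = affine hull B"
    using affine_basis_exists by blast
  have "int (card B) = CARD('n)"
    using aff_dim_unique[of B S'] B F_dim(1) by (simp add: S'(3) aff_dim_convex_hull)
  then have cardB: "card B = CARD('n)"
    by simp
  then have "B \<noteq> {}"
    by auto
  then obtain s0 where s0: "s0 \<in> B"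
    by blast
  define D where "D = (\<lambda>x. - s0 + x) ` (B - {s0})"
  have "independent D"
    using affine_dependent_iff_dependent2[OF s0] B(2) by (simp add: D_def)
  moreover have "card D = CARD('n) - 1"
    unfolding D_def using s0 cardB by (subst card_image) (auto simp: card_Diff_singleton)
  moreover have "lattice_point d" if "d \<in> D" for d
    using that lattice_S B(1) S'(1) s0 unfolding D_def
    by (auto simp: subset_iff intro!: lattice_point_diff)
  ultimately obtain a where a: "a \<noteq> 0" "lattice_point a" "\<And>d. d \<in> D \<Longrightarrow> inner a d = 0"
    using lattice_normal_exists by blast
  have "inner a x = inner a s0" if "x \<in> B" for x
    using a(3)[of "- s0 + x"] that by (cases "x = s0") (auto simp: D_def inner_diff_right)
  then have "affine hull B \<subseteq> {y. inner a y = inner a s0}"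
    by (intro hull_minimal) (auto simp: affine_hyperplane)
  then have aF: "\<forall>y\<in>F. inner a y = inner a s0"
    using S'(3) B(3) convex_hull_subset_affine_hull[of S'] by blast
  obtain c where c: "c \<noteq> 0" "a = c *\<^sub>R (- n0)"
    using facet_normals_proportional[OF F full_dim _ _ a(1) aF, of "- n0" "- \<beta>0"] \<open>n0 \<noteq> 0\<close> n0
    by auto
  \<comment> \<open>The sign turns the integer normal inward: \<open>a1\<close> is
    \<open>\<bar>c\<bar>\<close> times \<open>- n0\<close>.\<close>
  define a1 where "a1 = sgn c *\<^sub>R a"
  have "lattice_point a1" "a1 \<noteq> 0"
    using a c(1) lattice_point_scaleR[of "sgn c" a] by (simp_all add: a1_def sgn_if)
  then obtain g where g: "g > 0" "primitive (inverse g *\<^sub>R a1)"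
    using primitive_multiple_exists by blast
  define a2 where "a2 = inverse g *\<^sub>R a1"
  have a2: "a2 = - (\<bar>c\<bar> / g) *\<^sub>R n0"
    unfolding a2_def a1_def c(2) by (simp add: abs_sgn divide_inverse mult.commute mult.left_commute)
  have pos: "\<bar>c\<bar> / g > 0"
    using c g by simp
  show ?thesis
  proof
    show *: "\<forall>y\<in>F. inner a2 y = - (\<bar>c\<bar> / g) * \<beta>0"
      using n0 by (auto simp: a2)
    show "facet_ineq P a2 (- (\<bar>c\<bar> / g) * \<beta>0)"
      unfolding facet_ineq_def
    proof (intro conjI exI ballI)
      show "primitive a2"
        using g by (simp add: a2_def)
      show "F facet_of P" by (rule F)
      show "inner a2 y = - (\<bar>c\<bar> / g) * \<beta>0" if "y \<in> F" for y
        using * that by blast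
      show "inner a2 y \<ge> - (\<bar>c\<bar> / g) * \<beta>0" if "y \<in> P" for y
        using that n0 mult_left_mono[of "inner n0 y" \<beta>0 "\<bar>c\<bar> / g"] pos by (auto simp: a2)
    qed
  qed
qed

lemma facet_ineq_offset_Ints:
  assumes "facet_ineq P a b"
  shows "b \<in> \<int>"
proof -
  obtain F where F: "F facet_of P" "\<forall>y\<in>F. inner a y = b"
    using assms unfolding facet_ineq_def by blast
  obtain S' where S': "S' \<subseteq> S" "S' \<noteq> {}" "F = convex hull S'"
    using facet_vertices[OF F(1)] .
  then obtain s where "s \<in> S'" "s \<in> F" "s \<in> S"
    by (metis all_not_in_conv hull_inc subset_iff)
  then show ?thesis
    using assms F(2) lattice_S inner_lattice_point_Ints
    unfolding facet_ineq_def primitive_def by metis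
qed

text \<open>For each of the finitely many facets the primitive inward normal, and with it the
  offset, is unique.\<close>

lemma finite_facet_ineqs: "finite {(a, b). facet_ineq P a b}"
proof -
  define X where "X = (\<lambda>F. {(a, b). primitive a \<and> (\<forall>y\<in>F. inner a y = b) \<and> (\<forall>y\<in>P. inner a y \<ge> b)})"
  have "finite (X F)" if F: "F facet_of P" for F
  proof -
    have "p = q" if pq: "p \<in> X F" "q \<in> X F" for p q
    proof -
      obtain a b a' b' where ab: "p = (a, b)" "q = (a', b')"
        by fastforce
      obtain f where f: "f \<in> F"
        using F by (metis facet_of_def all_not_in_conv)
      have X: "primitive a" "\<forall>y\<in>F. inner a y = b" "\<forall>y\<in>P. inner a y \<ge> b"
        "primitive a'" "\<forall>y\<in>F. inner a' y = b'" "\<forall>y\<in>P. inner a' y \<ge> b'"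
        using pq by (auto simp: ab X_def)
      have "a \<noteq> 0" "a' \<noteq> 0"
        using X by (auto simp: primitive_def)
      then obtain c where "c > 0" "a' = c *\<^sub>R a"
        using facet_normals_proportional_pos[OF F full_dim _ X(2,3) _ X(5,6)] by blast
      then have "a' = a"
        using primitive_parallel_eq X(1,4) by blast
      then show ?thesis
        using X(2,5) f ab by auto
    qed
    then have "X F = {} \<or> (\<exists>p. X F = {p})"
      by blast
    then show ?thesis
      by auto
  qed
  moreover have "finite {F. F facet_of P}"
    by (rule finite_polytope_facets[OF polytope_P])
  moreover have "{(a, b). facet_ineq P a b} \<subseteq> (\<Union>F\<in>{F. F facet_of P}. X F)"
    by (auto simp: facet_ineq_def X_def)
  ultimately show ?thesis
    using finite_subset by blast
qed

lemma rel_interior_nonempty: "rel_interior P \<noteq> {}"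
  using full_dim by (auto simp: rel_interior_eq_empty P_eq)

lemma facet_ineq_strict:
  assumes "facet_ineq P a b" "x \<in> rel_interior P"
  shows "inner a x > b"
proof -
  have "x \<in> interior P"
    using assms(2) rel_interior_interior[OF affine_hull_P] by simp
  moreover have "P \<subseteq> {x. inner a x \<ge> b}"
    using assms(1) by (auto simp: facet_ineq_def)
  ultimately have "x \<in> interior {x. inner a x \<ge> b}"
    using interior_mono by blast
  then show ?thesis
    using assms(1) by (simp add: interior_halfspace_ge facet_ineq_def primitive_def)
qed

text \<open>Follow \<open>c\<close> from an interior point until it leaves the bounded
  \<open>P\<close>: the function of the facet reached drops from positive to zero. This is how
  boundedness of \<open>P\<close> enters the duality argument.\<close>

lemma facet_ineq_in_direction:
  assumes "c \<noteq> 0"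
  obtains a b where "facet_ineq P a b" "inner a c < 0"
proof -
  obtain x where x: "x \<in> rel_interior P"
    using rel_interior_nonempty by blast
  have "bounded P"
    using polytope_P by (rule polytope_imp_bounded)
  then obtain d where d: "0 < d" "x + d *\<^sub>R c \<in> rel_frontier P"
    using ray_to_rel_frontier[OF _ x _ assms] affine_hull_P by (metis UNIV_I)
  then obtain F where F: "F facet_of P" "x + d *\<^sub>R c \<in> F"
    using rel_frontier_of_polyhedron[OF polytope_imp_polyhedron[OF polytope_P]] by auto
  obtain a b where ab: "facet_ineq P a b" "\<forall>y\<in>F. inner a y = b"
    using facet_ineq_exists[OF F(1)] .
  have "inner a x + d * inner a c = b"
    using ab(2) F(2) by (metis inner_add_right inner_scaleR_right)
  then have "d * inner a c < 0"
    using facet_ineq_strict[OF ab(1) x] by linarith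
  then show ?thesis
    using that ab(1) d(1) by (simp add: mult_less_0_iff)
qed

end

section \<open>Linear programming duality for the codegree\<close>

lemma aff_eval_eq_inner: "aff_eval w x = inner w (x, 1)"
  by (simp add: aff_eval_def inner_prod_def)

lemma aff_eval_sum: "aff_eval (\<Sum>w\<in>V. c w *\<^sub>R w) x = (\<Sum>w\<in>V. c w * aff_eval w x)"
  by (simp add: aff_eval_eq_inner inner_sum_left)

lemma lattice_aff_eval_Ints: "lattice_aff w \<Longrightarrow> lattice_point x \<Longrightarrow> aff_eval w x \<in> \<int>"
  unfolding aff_eval_def lattice_aff_def by (intro Ints_add inner_lattice_point_Ints) auto

lemma lattice_point_normal: "facet_ineq P a b \<Longrightarrow> lattice_point a"
  by (simp add: facet_ineq_def primitive_def)

context full_lattice_polytope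
begin

text \<open>Offsets are negated so that \<open>aff_eval\<close> gives the lattice height above the
  facet hyperplane.\<close>

definition facet_affs :: "((real^'n) \<times> real) set" where
  "facet_affs = (\<lambda>(a, b). (a, - b)) ` {(a, b). facet_ineq P a b}"

lemma facet_affsI: "facet_ineq P a b \<Longrightarrow> (a, - b) \<in> facet_affs"
  by (force simp: facet_affs_def)

lemma finite_facet_affs: "finite facet_affs"
  unfolding facet_affs_def using finite_facet_ineqs by (rule finite_imageI)

lemma facet_affs_lattice: "w \<in> facet_affs \<Longrightarrow> lattice_aff w"
  using facet_ineq_offset_Ints lattice_point_normal[of P] by (auto simp: facet_affs_def lattice_aff_def)

lemma facet_affs_nonneg: "w \<in> facet_affs \<Longrightarrow> x \<in> P \<Longrightarrow> aff_eval w x \<ge> 0"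
  by (auto simp: facet_affs_def aff_eval_def facet_ineq_def)

lemma facet_affs_pos: "w \<in> facet_affs \<Longrightarrow> x \<in> rel_interior P \<Longrightarrow> aff_eval w x > 0"
  using facet_ineq_strict by (auto simp: facet_affs_def aff_eval_def)

lemma mem_adj_poly_iff: "x \<in> adj_poly P s \<longleftrightarrow> (\<forall>w\<in>facet_affs. aff_eval w x \<ge> s)"
  by (auto simp: adj_poly_def facet_affs_def aff_eval_def)

lemma facet_affs_direction:
  assumes "c \<noteq> 0"
  obtains w where "w \<in> facet_affs" "inner (fst w) c < 0"
proof -
  obtain a b where "facet_ineq P a b" "inner a c < 0"
    using facet_ineq_in_direction[OF assms] .
  then show ?thesis
    using that[OF facet_affsI] by simp
qed

lemma facet_affs_nonempty: "facet_affs \<noteq> {}"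
  using facet_affs_direction[of "axis undefined 1"] by (metis axis_eq_0_iff empty_iff zero_neq_one)

text \<open>Weak duality: at \<open>x\<close> all facet functions are at least \<open>s\<close>,
  hence so is every convex combination, and the given one is the constant
  \<open>\<tau>\<close>.\<close>

lemma hull_bounds_adj_poly:
  assumes "(0, \<tau>) \<in> convex hull facet_affs" "x \<in> adj_poly P s"
  shows "s \<le> \<tau>"
proof -
  have "facet_affs \<subseteq> {w. inner (x, 1) w \<ge> s}"
    using assms(2) by (auto simp: mem_adj_poly_iff aff_eval_eq_inner inner_commute)
  then have "convex hull facet_affs \<subseteq> {w. inner (x, 1) w \<ge> s}"
    by (rule hull_minimal) (rule convex_halfspace_ge)
  then show ?thesis
    using assms(1) by auto
qed

text \<open>If no convex combination of the normals vanished, a separating direction would be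
  positive on all of them, so no facet function would decrease along it.\<close>

lemma hull_meets_axis: "\<exists>\<tau>. (0, \<tau>) \<in> convex hull facet_affs"
proof -
  have "0 \<in> convex hull (fst ` facet_affs)"
  proof (rule ccontr)
    assume "0 \<notin> convex hull (fst ` facet_affs)"
    moreover have "closed (convex hull (fst ` facet_affs))"
      using finite_facet_affs by (simp add: finite_imp_compact_convex_hull compact_imp_closed)
    ultimately obtain c \<beta> where c: "c \<noteq> 0" "0 < \<beta>" "\<forall>x\<in>convex hull (fst ` facet_affs). inner c x > \<beta>"
      using separating_hyperplane_closed_0[OF convex_convex_hull] by blast
    obtain w where "w \<in> facet_affs" "inner (fst w) c < 0"
      using facet_affs_direction[OF c(1)] .
    moreover from this have "inner c (fst w) > \<beta>"
      using c(3) by (simp add: hull_inc)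
    ultimately show False
      using c(2) by (simp add: inner_commute)
  qed
  moreover have "convex hull (fst ` facet_affs) = fst ` (convex hull facet_affs)"
    by (simp add: convex_hull_linear_image linear_fst)
  ultimately show ?thesis
    by force
qed

definition adj_levels :: "real set" where
  "adj_levels = {s. s > 0 \<and> adj_poly P s \<noteq> {}}"

lemma bdd_above_adj_levels: "bdd_above adj_levels"
  using hull_meets_axis hull_bounds_adj_poly unfolding adj_levels_def bdd_above_def by blast

lemma adj_levels_nonempty: "adj_levels \<noteq> {}"
proof -
  obtain x where x: "x \<in> rel_interior P"
    using rel_interior_nonempty by blast
  define s where "s = Min ((\<lambda>w. aff_eval w x) ` facet_affs)"
  have "s > 0"
    unfolding s_def using finite_facet_affs facet_affs_nonempty facet_affs_pos[OF _ x]
    by (subst Min_gr_iff) auto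
  moreover have "x \<in> adj_poly P s"
    unfolding mem_adj_poly_iff s_def using finite_facet_affs by auto
  ultimately show ?thesis
    by (auto simp: adj_levels_def)
qed

lemma Sup_adj_levels_pos: "Sup adj_levels > 0"
proof -
  obtain s where "s \<in> adj_levels"
    using adj_levels_nonempty by blast
  moreover from this have "s > 0"
    by (simp add: adj_levels_def)
  ultimately show ?thesis
    using cSup_upper[OF _ bdd_above_adj_levels] by fastforce
qed

text \<open>Strong duality by separation: if every constant in the hull exceeded the supremum, a
  hyperplane would strictly separate the hull from a vertical ray.\<close>

lemma hull_meets_axis_below_Sup:
  "\<exists>\<tau>. \<tau> \<le> Sup adj_levels \<and> (0, \<tau>) \<in> convex hull facet_affs"
proof (rule ccontr)
  assume contra: "\<not> ?thesis"
  define s where "s = Sup adj_levels"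
  define L :: "((real^'n) \<times> real) set" where "L = {0} \<times> {..s}"
  have "convex L" "closed L"
    by (simp_all add: L_def convex_Times closed_Times)
  moreover have "convex hull facet_affs \<inter> L = {}"
    using contra by (auto simp: L_def s_def)
  moreover have "convex hull facet_affs \<noteq> {}" "compact (convex hull facet_affs)"
    using facet_affs_nonempty finite_facet_affs by (simp_all add: finite_imp_compact_convex_hull)
  ultimately obtain n \<beta> where sep: "\<forall>w\<in>convex hull facet_affs. inner n w < \<beta>" "\<forall>w\<in>L. inner n w > \<beta>"
    using separating_hyperplane_compact_closed[of "convex hull facet_affs" L] convex_convex_hull by blast
  obtain c \<gamma> where n: "n = (c, \<gamma>)"
    by fastforce
  have W: "inner (fst w) c + \<gamma> * snd w < \<beta>" if "w \<in> facet_affs" for w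
    using sep(1) that by (auto simp: n hull_inc inner_prod_def inner_commute)
  have L: "\<gamma> * \<tau> > \<beta>" if "\<tau> \<le> s" for \<tau>
    using sep(2) that by (auto simp: n L_def)
  consider "\<gamma> > 0" | "\<gamma> = 0" | "\<gamma> < 0"
    by linarith
  then show False
  proof cases
    case 1
    have "\<gamma> * min s (\<beta> / \<gamma>) \<le> \<gamma> * (\<beta> / \<gamma>)"
      using 1 by (intro mult_left_mono) auto
    then show False
      using L[of "min s (\<beta> / \<gamma>)"] 1 by simp
  next
    case 2
    \<comment> \<open>A horizontal \<open>n\<close> would make \<open>c\<close> negative on all
      normals, against \<open>facet_affs_direction\<close> for \<open>- c\<close>.\<close>
    then have neg: "inner (fst w) c < 0" if "w \<in> facet_affs" for w
      using W[OF that] L[of s] by simp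
    then have "- c \<noteq> 0"
      using facet_affs_nonempty by force
    then obtain w where "w \<in> facet_affs" "inner (fst w) (- c) < 0"
      using facet_affs_direction by blast
    then show False
      using neg[of w] by simp
  next
    case 3
    have lt: "s < \<beta> / \<gamma>"
      using L[of s] 3 by (simp add: field_simps)
    \<comment> \<open>Dividing by the negative \<open>\<gamma>\<close> reverses the separation, so
      this point reaches the level \<open>\<beta> / \<gamma>\<close> above the supremum.\<close>
    have "aff_eval w (inverse \<gamma> *\<^sub>R c) \<ge> \<beta> / \<gamma>" if "w \<in> facet_affs" for w
      using W[OF that] 3 by (simp add: aff_eval_def field_simps)
    then have "inverse \<gamma> *\<^sub>R c \<in> adj_poly P (\<beta> / \<gamma>)"
      by (simp add: mem_adj_poly_iff)
    then have "\<beta> / \<gamma> \<in> adj_levels"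
      using lt Sup_adj_levels_pos by (auto simp: adj_levels_def s_def)
    then show False
      using cSup_upper[OF _ bdd_above_adj_levels] lt by (fastforce simp: s_def)
  qed
qed

section \<open>Dual solutions with independent support\<close>

definition dual_feasible :: "((real^'n) \<times> real) set \<Rightarrow> ((real^'n) \<times> real \<Rightarrow> real) \<Rightarrow> bool" where
  "dual_feasible V c \<longleftrightarrow> V \<subseteq> facet_affs \<and> (\<forall>w\<in>V. c w \<ge> 0) \<and> (\<Sum>w\<in>V. c w *\<^sub>R w) = (0, 1) \<and>
     Q_codegree P \<le> sum c V"

text \<open>A constant \<open>\<tau>\<close> in the hull is positive by weak duality. Dividing its
  weights by \<open>\<tau>\<close> represents the constant 1 with total
  \<open>inverse \<tau>\<close>, which is at least the codegree when \<open>\<tau>\<close> is at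
  most the supremum.\<close>

lemma dual_feasible_exists: "\<exists>c. dual_feasible facet_affs c"
proof -
  obtain \<tau> where \<tau>: "\<tau> \<le> Sup adj_levels" "(0, \<tau>) \<in> convex hull facet_affs"
    using hull_meets_axis_below_Sup by blast
  obtain s where "s \<in> adj_levels"
    using adj_levels_nonempty by blast
  then have pos: "\<tau> > 0"
    using hull_bounds_adj_poly[OF \<tau>(2)] unfolding adj_levels_def by fastforce
  obtain u where u: "\<forall>w\<in>facet_affs. 0 \<le> u w" "sum u facet_affs = 1"
    "(\<Sum>w\<in>facet_affs. u w *\<^sub>R w) = (0, \<tau>)"
    using \<tau>(2) convex_hull_finite[OF finite_facet_affs] by auto
  define c where "c = (\<lambda>w. inverse \<tau> * u w)"
  have "(\<Sum>w\<in>facet_affs. c w *\<^sub>R w) = inverse \<tau> *\<^sub>R (\<Sum>w\<in>facet_affs. u w *\<^sub>R w)"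
    by (simp add: c_def scaleR_sum_right)
  then have "(\<Sum>w\<in>facet_affs. c w *\<^sub>R w) = (0, 1)"
    using u(3) pos by simp
  moreover have "sum c facet_affs = inverse \<tau>"
    using u(2) by (simp add: c_def sum_distrib_left[symmetric])
  moreover have "Q_codegree P \<le> inverse \<tau>"
    using \<tau>(1) pos unfolding Q_codegree_def adj_levels_def by (simp add: le_imp_inverse_le)
  ultimately show ?thesis
    using u(1) pos by (intro exI[of _ c]) (simp add: dual_feasible_def c_def)
qed

lemma dual_feasible_remove:
  assumes "dual_feasible V c" "w \<in> V" "c w = 0"
  shows "dual_feasible (V - {w}) c"
proof -
  have "finite V"
    using assms(1) finite_facet_affs finite_subset by (auto simp: dual_feasible_def)
  then have "sum c (V - {w}) = sum c V" "(\<Sum>w\<in>V - {w}. c w *\<^sub>R w) = (\<Sum>w\<in>V. c w *\<^sub>R w)"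
    using assms(2,3) by (simp_all add: sum_diff1)
  then show ?thesis
    using assms(1) by (auto simp: dual_feasible_def)
qed

text \<open>A feasible support of least size is chosen. A linear relation would allow shifting the
  weights, without lowering their total, until one vanishes, and deleting it would contradict
  minimality.\<close>

lemma basic_dual_solution:
  obtains V c where "dual_feasible V c" "independent V" "\<And>w. w \<in> V \<Longrightarrow> c w > 0"
proof -
  define n where "n = (LEAST n. \<exists>V c. dual_feasible V c \<and> card V = n)"
  have "\<exists>V c. dual_feasible V c \<and> card V = n"
    unfolding n_def by (rule LeastI_ex) (use dual_feasible_exists in blast)
  then obtain V c where Vc: "dual_feasible V c" "card V = n"
    by blast
  have least: "n \<le> card V'" if "dual_feasible V' c'" for V' c'
    unfolding n_def using that by (intro Least_le) blast
  have fin: "finite V"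
    using Vc(1) finite_facet_affs finite_subset by (auto simp: dual_feasible_def)
  have nonzero: "c' w \<noteq> 0" if "dual_feasible V c'" "w \<in> V" for c' w
  proof
    assume "c' w = 0"
    then have "n \<le> card (V - {w})"
      using least dual_feasible_remove that by blast
    then show False
      using that(2) fin Vc(2) card_Diff1_less by fastforce
  qed
  have pos: "c w > 0" if "w \<in> V" for w
    using nonzero[OF Vc(1) that] Vc(1) that by (force simp: dual_feasible_def)
  have "independent V"
  proof (rule ccontr)
    assume "\<not> independent V"
    then obtain d0 where d0: "\<exists>w\<in>V. d0 w \<noteq> 0" "(\<Sum>w\<in>V. d0 w *\<^sub>R w) = 0"
      using dependent_finite[OF fin] by auto
    \<comment> \<open>A relation or its negative has nonnegative sum, so moving along it does not
      lower the total weight.\<close>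
    obtain d where d: "\<exists>w\<in>V. d w \<noteq> 0" "(\<Sum>w\<in>V. d w *\<^sub>R w) = 0" "sum d V \<ge> 0"
    proof (cases "sum d0 V \<ge> 0")
      case True
      then show ?thesis
        using that[of d0] d0 by simp
    next
      case False
      then show ?thesis
        using that[of "\<lambda>w. - d0 w"] d0 by (simp add: sum_negf)
    qed
    \<comment> \<open>All of \<open>V\<close> is positive at an interior point, so a nontrivial
      relation cannot have only nonnegative coefficients.\<close>
    have "\<exists>w\<in>V. d w < 0"
    proof (rule ccontr)
      assume "\<not> ?thesis"
      then have nonneg: "\<forall>w\<in>V. d w \<ge> 0"
        by force
      obtain x where x: "x \<in> rel_interior P"
        using rel_interior_nonempty by blast
      have ev: "aff_eval w x > 0" if "w \<in> V" for w
        using facet_affs_pos[OF _ x] Vc(1) that unfolding dual_feasible_def by blast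
      have "(\<Sum>w\<in>V. d w * aff_eval w x) = 0"
        using aff_eval_sum[of d V x] d(2) by (simp add: aff_eval_def)
      moreover have "\<forall>w\<in>V. d w * aff_eval w x \<ge> 0"
        using nonneg ev by (simp add: less_imp_le)
      ultimately have "d w * aff_eval w x = 0" if "w \<in> V" for w
        using sum_nonneg_0[OF fin, of "\<lambda>w. d w * aff_eval w x" w] that by blast
      then show False
        using d(1) ev by (metis less_irrefl mult_eq_0_iff)
    qed
    then have ne: "{w\<in>V. d w < 0} \<noteq> {}" "finite {w\<in>V. d w < 0}"
      using fin by auto
    \<comment> \<open>The ratio test: the largest step keeping all weights nonnegative, at which the
      weight of \<open>w1\<close> becomes zero.\<close>
    define t where "t = Min ((\<lambda>w. c w / - d w) ` {w\<in>V. d w < 0})"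
    have "t \<in> (\<lambda>w. c w / - d w) ` {w\<in>V. d w < 0}"
      unfolding t_def using ne by (intro Min_in) auto
    then obtain w1 where w1: "w1 \<in> V" "d w1 < 0" "t = c w1 / - d w1"
      by blast
    have t: "t \<ge> 0"
      using w1 pos[OF w1(1)] by (simp add: divide_nonneg_nonpos divide_nonpos_neg less_imp_le)
    have tle: "t \<le> c w / - d w" if "w \<in> V" "d w < 0" for w
      unfolding t_def using ne that by (intro Min_le) auto
    define c' where "c' = (\<lambda>w. c w + t * d w)"
    have "c' w \<ge> 0" if "w \<in> V" for w
    proof (cases "d w < 0")
      case True
      then show ?thesis
        using tle[OF that True] by (simp add: c'_def field_simps)
    next
      case False
      then show ?thesis
        using t pos[OF that] by (simp add: c'_def)
    qed
    moreover have "(\<Sum>w\<in>V. c' w *\<^sub>R w) = (\<Sum>w\<in>V. c w *\<^sub>R w) + t *\<^sub>R (\<Sum>w\<in>V. d w *\<^sub>R w)"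
      by (simp add: c'_def scaleR_add_left sum.distrib scaleR_sum_right)
    moreover have "sum c' V = sum c V + t * sum d V"
      by (simp add: c'_def sum.distrib sum_distrib_left)
    ultimately have "dual_feasible V c'"
      using Vc(1) d t by (auto simp: dual_feasible_def intro: order_trans)
    moreover have "c' w1 = 0"
      using w1 by (simp add: c'_def)
    ultimately show False
      using nonzero w1(1) by blast
  qed
  then show ?thesis
    using that Vc(1) pos by blast
qed

section \<open>Cayley partitions\<close>

lemma aff_eval_zero_on_S:
  assumes "\<And>s. s \<in> S \<Longrightarrow> aff_eval w s = 0"
  shows "w = 0"
proof -
  have "S \<subseteq> {x. inner (fst w) x = - snd w}"
    using assms by (simp add: aff_eval_def subset_iff eq_neg_iff_add_eq_0)
  then have "affine hull S \<subseteq> {x. inner (fst w) x = - snd w}"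
    by (rule hull_minimal) (rule affine_hyperplane)
  then have "inner (fst w) x = - snd w" for x
    using affine_hull_P by (auto simp: P_eq)
  \<comment> \<open>The value at 0 gives the constant, and the value at \<open>fst w\<close> then
    the squared norm of the linear part.\<close>
  from this[of 0] this[of "fst w"] show ?thesis
    by (simp add: prod_eq_iff)
qed

lemma facet_affs_values:
  assumes "w \<in> facet_affs" "s \<in> S"
  shows "aff_eval w s = 0 \<or> aff_eval w s = 1 \<or> aff_eval w s \<ge> 2"
proof -
  obtain k :: int where k: "aff_eval w s = k"
    using lattice_aff_eval_Ints[OF facet_affs_lattice[OF assms(1)] lattice_S[OF assms(2)]]
    by (auto elim: Ints_cases)
  moreover have "aff_eval w s \<ge> 0"
    using facet_affs_nonneg[OF assms(1)] S_subset_P assms(2) by blast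
  ultimately have "k = 0 \<or> k = 1 \<or> k \<ge> 2"
    by simp linarith
  then show ?thesis
    using k by auto
qed

text \<open>The functions map \<open>S\<close> onto the vertices of a simplex. The last clause keeps
  every fibre nonempty, so that each Cayley summand is a polytope.\<close>

definition cayley_partition :: "((real^'n) \<times> real) set \<Rightarrow> bool" where
  "cayley_partition J \<longleftrightarrow> finite J \<and> J \<noteq> {} \<and> (\<forall>w\<in>J. lattice_aff w) \<and>
     (\<forall>s\<in>S. \<exists>w\<in>J. aff_eval w s = 1 \<and> (\<forall>w'\<in>J. w' \<noteq> w \<longrightarrow> aff_eval w' s = 0)) \<and>
     (\<forall>w\<in>J. \<exists>s\<in>S. aff_eval w s = 1)"

text \<open>At a point of the class of \<open>w\<close> all other members vanish, so the members are
  independent in the space of affine functions, which has dimension n + 1.\<close>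

lemma cayley_partition_card_le:
  assumes "cayley_partition J"
  shows "card J \<le> CARD('n) + 1"
proof -
  have fin: "finite J"
    using assms by (simp add: cayley_partition_def)
  have "independent J"
  proof (rule ccontr)
    assume "\<not> independent J"
    then obtain d w where d: "w \<in> J" "d w \<noteq> 0" "(\<Sum>w\<in>J. d w *\<^sub>R w) = 0"
      using dependent_finite[OF fin] by auto
    obtain s where s: "s \<in> S" "aff_eval w s = 1"
      using assms d(1) unfolding cayley_partition_def by blast
    obtain w0 where "w0 \<in> J" "\<forall>w'\<in>J. w' \<noteq> w0 \<longrightarrow> aff_eval w' s = 0"
      using assms s(1) unfolding cayley_partition_def by blast
    then have zero: "aff_eval w' s = 0" if "w' \<in> J" "w' \<noteq> w" for w'
      using s(2) d(1) that by (metis zero_neq_one)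
    have "0 = (\<Sum>w\<in>J. d w * aff_eval w s)"
      using aff_eval_sum[of d J s] d(3) by (simp add: aff_eval_def)
    also have "\<dots> = (\<Sum>v\<in>J. if v = w then d w else 0)"
      using zero s(2) by (intro sum.cong) auto
    also have "\<dots> = d w"
      using d(1) fin by simp
    finally show False
      using d(2) by simp
  qed
  then show ?thesis
    using independent_bound[of J] by simp
qed

text \<open>The facet functions with weight above 1/2 take values in \<open>{0, 1}\<close> on the vertices, and no two
  of them are nonzero at the same vertex, since the weighted values sum to 1. Together with
  the remainder they partition the constant function 1.\<close>

lemma cayley_partition_exists:
  obtains J where "cayley_partition J"
    "real (card J) \<ge> 2 * Q_codegree P - CARD('n) \<or>
      Q_codegree P \<le> real (card J) \<and> card J \<le> CARD('n) + 1"
proof -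
  obtain V c where Vc: "dual_feasible V c" "independent V" and pos: "\<And>w. w \<in> V \<Longrightarrow> c w > 0"
    using basic_dual_solution by blast
  have VW: "w \<in> facet_affs" if "w \<in> V" for w
    using Vc(1) that unfolding dual_feasible_def by blast
  have fin: "finite V"
    using VW finite_subset[OF _ finite_facet_affs] by (simp add: subset_iff)
  have cardV: "card V \<le> CARD('n) + 1"
    using independent_bound[OF Vc(2)] by simp
  have sum_w: "(\<Sum>w\<in>V. c w *\<^sub>R w) = (0, 1)" and sum_c: "Q_codegree P \<le> sum c V"
    using Vc(1) by (simp_all add: dual_feasible_def)
  have eval_V: "(\<Sum>w\<in>V. c w * aff_eval w s) = 1" for s
    using aff_eval_sum[of c V s] sum_w by (simp add: aff_eval_def)
  have nonneg: "aff_eval w s \<ge> 0" if "w \<in> V" "s \<in> S" for w s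
    using facet_affs_nonneg[OF VW[OF that(1)]] S_subset_P that(2) by blast
  have eval_cases: "aff_eval w s = 0 \<or> aff_eval w s = 1 \<or> aff_eval w s \<ge> 2" if "w \<in> V" "s \<in> S" for w s
    using facet_affs_values[OF VW[OF that(1)] that(2)] .
  have partial_sum: "(\<Sum>w\<in>A. c w * aff_eval w s) \<le> 1" if "A \<subseteq> V" "s \<in> S" for A s
    using sum_mono2[OF fin that(1), of "\<lambda>w. c w * aff_eval w s"] eval_V nonneg pos that(2)
    by (metis DiffD1 less_imp_le mult_nonneg_nonneg)
  have nonzero: "\<exists>s\<in>S. aff_eval w s \<ge> 1" if "w \<in> V" for w
  proof (rule ccontr)
    assume "\<not> ?thesis"
    then have "aff_eval w s = 0" if "s \<in> S" for s
      using eval_cases[OF \<open>w \<in> V\<close> that] that by force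
    then have "w = 0"
      by (rule aff_eval_zero_on_S)
    then show False
      using that Vc(2) dependent_zero by blast
  qed
  \<comment> \<open>At a point where the value of \<open>w\<close> is at least 1, its single term in
    the weighted sum is bounded by the total 1.\<close>
  have c_le: "c w \<le> 1" if "w \<in> V" for w
  proof -
    obtain s where s: "s \<in> S" "aff_eval w s \<ge> 1"
      using nonzero \<open>w \<in> V\<close> by blast
    have "c w * 1 \<le> c w * aff_eval w s"
      using s(2) pos[OF that] by (intro mult_left_mono) auto
    also have "\<dots> \<le> 1"
      using partial_sum[of "{w}" s] that s by simp
    finally show ?thesis
      by simp
  qed
  define I where "I = {w\<in>V. c w > 1 / 2}"
  have IV: "I \<subseteq> V" and finI: "finite I"
    using fin by (auto simp: I_def)
  have I01: "aff_eval w s = 0 \<or> aff_eval w s = 1" if "w \<in> I" "s \<in> S" for w s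
  proof (rule ccontr)
    assume "\<not> ?thesis"
    then have "aff_eval w s \<ge> 2"
      using eval_cases[of w s] that IV by blast
    then have "c w * 2 \<le> c w * aff_eval w s"
      using pos[of w] that(1) IV by (intro mult_left_mono) auto
    moreover have "1 < c w * 2"
      using that(1) by (simp add: I_def)
    moreover have "c w * aff_eval w s \<le> 1"
      using partial_sum[of "{w}" s] that IV by auto
    ultimately show False
      by linarith
  qed
  have I_disj: "aff_eval w' s = 0" if "w \<in> I" "w' \<in> I" "w' \<noteq> w" "s \<in> S" "aff_eval w s = 1" for w w' s
  proof (rule ccontr)
    assume "aff_eval w' s \<noteq> 0"
    then have "aff_eval w' s = 1"
      using I01 that by blast
    then have "c w + c w' \<le> 1"
      using partial_sum[of "{w, w'}" s] that IV by auto
    then show False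
      using that by (auto simp: I_def)
  qed
  \<comment> \<open>The remainder completes the sum over \<open>I\<close> to the constant 1; on
    \<open>S\<close> it is 1 where all of \<open>I\<close> vanishes and 0 elsewhere.\<close>
  define r where "r = (0, 1) - (\<Sum>w\<in>I. w)"
  have eval_r: "aff_eval r s = 1 - (\<Sum>w\<in>I. aff_eval w s)" for s
    using aff_eval_sum[of "\<lambda>_. 1" I s]
    by (simp add: r_def aff_eval_eq_inner inner_diff_left)
  have r0: "aff_eval r s = 0" if "w \<in> I" "s \<in> S" "aff_eval w s = 1" for w s
  proof -
    have "(\<Sum>v\<in>I. aff_eval v s) = (\<Sum>v\<in>I. if v = w then 1 else 0)"
      using I_disj that by (intro sum.cong) auto
    then show ?thesis
      using that(1) finI by (simp add: eval_r)
  qed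
  have r1: "aff_eval r s = 1" if "\<And>w. w \<in> I \<Longrightarrow> aff_eval w s = 0" for s
    using that by (simp add: eval_r)
  have lattice_I: "lattice_aff w" if "w \<in> I" for w
    using that IV VW facet_affs_lattice by blast
  have lattice_r: "lattice_aff r"
    using lattice_I lattice_point_diff[OF lattice_point_zero lattice_point_sum[of I fst]]
    by (auto simp: r_def lattice_aff_def fst_sum snd_sum)
  have I1: "\<exists>s\<in>S. aff_eval w s = 1" if "w \<in> I" for w
    using nonzero[of w] that IV I01[OF that] by fastforce
  \<comment> \<open>Weights are at most 1 on \<open>I\<close> and at most 1/2 on the rest of
    \<open>V\<close>.\<close>
  have sum_le: "sum c V \<le> (card I + card V) / 2"
  proof -
    have "sum c V = sum c I + sum c (V - I)"
      using sum.subset_diff[OF IV fin, of c] by simp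
    also have "sum c I \<le> real (card I) * 1"
      using c_le IV by (intro sum_bounded_above) auto
    also have "sum c (V - I) \<le> real (card (V - I)) * (1 / 2)"
      by (intro sum_bounded_above) (auto simp: I_def)
    also have "real (card (V - I)) = real (card V) - real (card I)"
      using IV fin by (simp add: card_Diff_subset finI card_mono of_nat_diff)
    finally show ?thesis
      by (simp add: field_simps)
  qed
  show ?thesis
  proof (cases "r = 0")
    case True
    have part: "\<exists>w\<in>I. aff_eval w s = 1" if "s \<in> S" for s
    proof (rule ccontr)
      assume "\<not> ?thesis"
      then have "aff_eval r s = 1"
        using I01 that by (intro r1) blast
      then show False
        by (simp add: True aff_eval_def)
    qed
    have "S \<noteq> {}"
      using full_dim by (auto simp: P_eq)
    then have "cayley_partition I"
      unfolding cayley_partition_def using finI lattice_I part I1 I_disj by blast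
    moreover have "sum c V = card I"
    proof -
      \<comment> \<open>The constant 1 is both the sum over \<open>I\<close> and the weighted sum
        over \<open>V\<close>, so independence of \<open>V\<close> forces the weights to be the
        indicator of \<open>I\<close>.\<close>
      have "(\<Sum>w\<in>V. (c w - (if w \<in> I then 1 else 0)) *\<^sub>R w) = 0"
      proof -
        have "(\<Sum>w\<in>V. (if w \<in> I then 1 else 0) *\<^sub>R w) = (\<Sum>w\<in>V. if w \<in> I then w else 0)"
          by (intro sum.cong) auto
        also have "\<dots> = (\<Sum>w\<in>I. w)"
          using fin IV by (simp add: sum.inter_restrict[symmetric] Int_absorb1)
        also have "\<dots> = (0, 1)"
          using True by (simp add: r_def)
        finally show ?thesis
          by (simp add: scaleR_diff_left sum_subtractf sum_w)
      qed
      then have "c w - (if w \<in> I then 1 else 0) = 0" if "w \<in> V" for w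
        using independentD[OF Vc(2) fin order_refl _ that, of "\<lambda>w. c w - (if w \<in> I then 1 else 0)"]
        by blast
      then have "sum c V = (\<Sum>w\<in>V. if w \<in> I then 1 else 0)"
        by (intro sum.cong) auto
      then show ?thesis
        using fin IV by (simp add: sum.inter_restrict[symmetric] Int_absorb1)
    qed
    ultimately show ?thesis
      using that sum_c cardV card_mono[OF fin IV] by force
  next
    case False
    \<comment> \<open>A nonzero remainder is nonzero at some point of \<open>S\<close>; there all of
      \<open>I\<close> vanishes, so the remainder has a nonempty class of its own.\<close>
    then obtain s where s: "s \<in> S" "aff_eval r s \<noteq> 0"
      using aff_eval_zero_on_S by blast
    have s0: "aff_eval w s = 0" if "w \<in> I" for w
      using r0[OF that s(1)] I01[OF that s(1)] s(2) by blast
    then have s1: "aff_eval r s = 1"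
      by (rule r1)
    then have rI: "r \<notin> I"
      using s0[of r] by auto
    have part: "\<exists>w\<in>insert r I. aff_eval w s' = 1 \<and> (\<forall>w'\<in>insert r I. w' \<noteq> w \<longrightarrow> aff_eval w' s' = 0)"
      if s': "s' \<in> S" for s'
    proof (cases "\<exists>w\<in>I. aff_eval w s' = 1")
      case True
      then obtain w where w: "w \<in> I" "aff_eval w s' = 1"
        by blast
      then show ?thesis
        using r0[OF w(1) s' w(2)] I_disj[OF w(1) _ _ s' w(2)] by blast
    next
      case False
      then have "aff_eval w s' = 0" if "w \<in> I" for w
        using I01[OF that s'] that by blast
      then show ?thesis
        using r1[of s'] by blast
    qed
    have "cayley_partition (insert r I)"
      unfolding cayley_partition_def
    proof (intro conjI ballI)
      show "lattice_aff w" if "w \<in> insert r I" for w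
        using that lattice_I lattice_r by blast
      show "\<exists>s\<in>S. aff_eval w s = 1" if "w \<in> insert r I" for w
        using that I1 s(1) s1 by blast
    qed (use finI part in auto)
    \<comment> \<open>As \<open>V\<close> has at most n + 1 members, \<open>sum_le\<close> gives at
      least \<open>2 * Q_codegree P - CARD('n) - 1\<close> members of \<open>I\<close>; the
      remainder adds one.\<close>
    moreover have "real (card (insert r I)) \<ge> 2 * Q_codegree P - CARD('n)"
      using sum_le sum_c cardV finI rI by simp
    ultimately show ?thesis
      using that by blast
  qed
qed

text \<open>Any coordinate set of the right size can carry the simplex directions, with one member
  of \<open>J\<close> left for the fibre over 0.\<close>

lemma cayley_decomposition:
  assumes J: "cayley_partition J" and T: "card T + 1 = card J"
  obtains P0 Q where "lattice_polytope P0" "in_base_space T P0"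
    "\<forall>j\<in>T. lattice_polytope (Q j) \<and> in_base_space T (Q j)"
    "unimod_equiv P (cayley_sum T P0 Q)"
proof -
  obtain w0 where w0: "w0 \<in> J"
    using J unfolding cayley_partition_def by blast
  have "finite J"
    using J by (simp add: cayley_partition_def)
  then have "card T = card (J - {w0})" "finite (J - {w0})"
    using w0 T by simp_all
  then obtain h where "bij_betw h T (J - {w0})"
    using finite_same_card_bij[OF finite] by blast
  then show ?thesis
    using cayley_sum_of_partition[OF finite_S lattice_S, of J w0 h T] J w0 that
    unfolding cayley_partition_def P_eq by blast
qed

end

section \<open>From the size of the partition to the dimension bound\<close>

theorem theorem3p4:
  fixes P :: "(real^'n) set"
  assumes "lattice_polytope P"
    and "aff_dim P = int CARD('n)"
    and "\<not> unimod_equiv P unimodular_simplex"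
    and "real CARD('n) > dP P"
  shows "\<exists>T::'n set. \<exists>P0 Q.
           real (card (UNIV - T)) \<le> dP P
         \<and> lattice_polytope P0 \<and> in_base_space T P0
         \<and> (\<forall>j\<in>T. lattice_polytope (Q j) \<and> in_base_space T (Q j))
         \<and> unimod_equiv P (cayley_sum T P0 Q)"
proof -
  obtain S where S: "finite S" "\<And>s. s \<in> S \<Longrightarrow> lattice_point s" "P = convex hull S"
    using assms(1) unfolding lattice_polytope_def by blast
  then interpret full_lattice_polytope S P
    using assms(2) by (simp add: full_lattice_polytope.intro)
  obtain J where J: "cayley_partition J" and bound: "real (card J) \<ge> 2 * Q_codegree P - CARD('n) \<or>
      Q_codegree P \<le> real (card J) \<and> card J \<le> CARD('n) + 1"
    using cayley_partition_exists .
  \<comment> \<open>With n + 1 classes the base space is a point and \<open>P\<close> would be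
    equivalent to the unimodular simplex.\<close>
  have "card J \<noteq> CARD('n) + 1"
  proof
    assume "card J = CARD('n) + 1"
    then obtain P0 Q where PQ: "lattice_polytope P0" "in_base_space UNIV P0"
      "\<forall>j\<in>UNIV. lattice_polytope (Q j) \<and> in_base_space UNIV (Q j)"
      "unimod_equiv P (cayley_sum UNIV P0 Q)"
      using cayley_decomposition[OF J, of UNIV] by auto
    then show False
      using assms(3) cayley_sum_points_eq_unimodular_simplex[of P0 Q] by simp
  qed
  then have le: "card J \<le> CARD('n)"
    using cayley_partition_card_le[OF J] by simp
  have "card J \<noteq> 0"
    using J by (simp add: cayley_partition_def)
  moreover obtain T :: "'n set" where T: "card T = card J - 1"
    using obtain_subset_with_card_n[of "card J - 1" "UNIV :: 'n set"] le by fastforce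
  ultimately have TJ: "card T + 1 = card J"
    by simp
  have card_compl: "real (card (UNIV - T)) = real CARD('n) + 1 - real (card J)"
    using TJ card_mono[of UNIV T] by (simp add: card_Diff_subset of_nat_diff flip: TJ)
  have "real (card (UNIV - T)) \<le> dP P"
  proof (cases "Q_codegree P \<in> \<nat>")
    case True
    \<comment> \<open>The first alternative of \<open>bound\<close> is exactly the claim; in the
      second, \<open>card J \<ge> Q_codegree P\<close> is combined with
      \<open>card J \<le> CARD('n)\<close>.\<close>
    then show ?thesis
      using bound le card_compl by (auto simp: dP_def Let_def)
  next
    case False
    define m where "m = \<lfloor>Q_codegree P\<rfloor>"
    have "real_of_int m < Q_codegree P"
    proof -
      have "real_of_int m \<noteq> Q_codegree P"
      proof
        assume *: "real_of_int m = Q_codegree P"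
        \<comment> \<open>The sign matters because an integer codegree must be shown to be a natural
          number.\<close>
        have "Q_codegree P \<ge> 0"
          using Sup_adj_levels_pos by (simp add: Q_codegree_def adj_levels_def)
        then have "Q_codegree P = real (nat m)"
          using * by linarith
        then show False
          using False by (metis of_nat_in_Nats)
      qed
      then show ?thesis
        unfolding m_def by (simp add: order_less_le)
    qed
    \<comment> \<open>Since \<open>m\<close> is strictly below the codegree, \<open>card J\<close>
      strictly exceeds \<open>2 * m - int CARD('n)\<close>, and integrality gains one.\<close>
    then have "2 * m - int CARD('n) + 1 \<le> int (card J)"
      using bound le by linarith
    then have "real_of_int (2 * m - int CARD('n) + 1) \<le> real_of_int (int (card J))"
      by (simp only: of_int_le_iff)
    then show ?thesis
      using False card_compl by (simp add: dP_def Let_def m_def)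
  qed
  then show ?thesis
    using cayley_decomposition[OF J TJ] by metis
qed

end
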